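(* Let $R$ be a commutative ring with unity, let $C$ be an $R$-coalgebra that is flat as an $R$-module, and let $M$ be a right $C$-comodule. An element $f\in End^{C}(M)$ is clean if and only if there exist $C$-comodule decompositions $M=A\oplus B=X\oplus Y$ such that $f(A)\subseteq X$, $(1-f)(B)\subseteq Y$, and both $f:A\rightarrow X$ and $1-f:B\rightarrow Y$ are isomorphisms.
   Context: $(C,\Delta,\varepsilon)$ is a coassociative counital $R$-coalgebra. A right $C$-comodule is $(M,\varrho^{M})$ with $\varrho^M:M\to M\otimes_R C$ coassociative and counital; a $C$-comodule morphism $g:M\to N$ is an $R$-linear map with $\varrho^N\circ g=(g\otimes I_C)\circ\varrho^M$. $End^{C}(M)$ is the ring of $C$-comodule endomorphisms of $M$, and $1=I_M$. A $C$-comodule decomposition $M=A\oplus B$ is a direct sum decomposition into $C$-subcomodules; isomorphisms are $C$-comodule isomorphisms. An element of a ring is clean if it is the sum of a unit and an idempotent of the ring. *)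

theory Defs
  imports "HOL-Algebra.Module" "HOL-Algebra.AbelCoset"
begin

section \<open>Linear maps, free modules and quotient modules\<close>

definition linear_maps ::
    "('a, 'r) ring_scheme \<Rightarrow> ('a, 'b, 'm) module_scheme \<Rightarrow> ('a, 'c, 'n) module_scheme \<Rightarrow> ('b \<Rightarrow> 'c) set"
  where "linear_maps R M N =
    {g \<in> carrier M \<rightarrow> carrier N.
      (\<forall>x\<in>carrier M. \<forall>y\<in>carrier M. g (x \<oplus>\<^bsub>M\<^esub> y) = g x \<oplus>\<^bsub>N\<^esub> g y) \<and>
      (\<forall>r\<in>carrier R. \<forall>x\<in>carrier M. g (r \<odot>\<^bsub>M\<^esub> x) = r \<odot>\<^bsub>N\<^esub> g x)}"

text \<open>The library's module records extend ring records. A module has no product, so the fields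
  \<open>mult\<close> and \<open>one\<close> of the modules built below carry no information.\<close>

definition ring_as_module :: "('a, 'r) ring_scheme \<Rightarrow> ('a, 'a) module"
  where "ring_as_module R =
    \<lparr>carrier = carrier R, mult = mult R, one = one R, zero = zero R, add = add R, smult = mult R\<rparr>"

definition free_module :: "('a, 'r) ring_scheme \<Rightarrow> 's set \<Rightarrow> ('a, 's \<Rightarrow> 'a) module"
  where "free_module R S =
    \<lparr>carrier = {u. (\<forall>s. u s \<in> carrier R) \<and> (\<forall>s. s \<notin> S \<longrightarrow> u s = \<zero>\<^bsub>R\<^esub>) \<and> finite {s. u s \<noteq> \<zero>\<^bsub>R\<^esub>}},
     mult = undefined, one = undefined,
     zero = (\<lambda>s. \<zero>\<^bsub>R\<^esub>), add = (\<lambda>u v s. u s \<oplus>\<^bsub>R\<^esub> v s), smult = (\<lambda>r u s. r \<otimes>\<^bsub>R\<^esub> u s)\<rparr>"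

definition free_gen :: "('a, 'r) ring_scheme \<Rightarrow> 's \<Rightarrow> 's \<Rightarrow> 'a"
  where "free_gen R s = (\<lambda>t. if t = s then \<one>\<^bsub>R\<^esub> else \<zero>\<^bsub>R\<^esub>)"

definition submodule_generated ::
    "('a, 'r) ring_scheme \<Rightarrow> ('a, 'b, 'm) module_scheme \<Rightarrow> 'b set \<Rightarrow> 'b set"
  where "submodule_generated R M S = \<Inter>{H. submodule H R M \<and> S \<subseteq> H}"

definition quotient_module :: "('a, 'b, 'm) module_scheme \<Rightarrow> 'b set \<Rightarrow> ('a, 'b set) module"
  where "quotient_module M H =
    \<lparr>carrier = a_rcosets\<^bsub>M\<^esub> H, mult = undefined, one = undefined,
     zero = H, add = set_add M, smult = (\<lambda>r T. \<Union>x\<in>T. H +>\<^bsub>M\<^esub> (r \<odot>\<^bsub>M\<^esub> x))\<rparr>"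


section \<open>Tensor products of modules over a commutative ring\<close>

type_synonym ('a, 'b, 'c) tensor = "('b \<times> 'c \<Rightarrow> 'a) set"

definition tensor_relators ::
    "('a, 'r) ring_scheme \<Rightarrow> ('a, 'b, 'm) module_scheme \<Rightarrow> ('a, 'c, 'n) module_scheme
      \<Rightarrow> ('b \<times> 'c \<Rightarrow> 'a) set"
  where "tensor_relators R M N =
    (let F = free_module R (carrier M \<times> carrier N); e = free_gen R in
      {e (x \<oplus>\<^bsub>M\<^esub> x', y) \<ominus>\<^bsub>F\<^esub> (e (x, y) \<oplus>\<^bsub>F\<^esub> e (x', y)) | x x' y.
          x \<in> carrier M \<and> x' \<in> carrier M \<and> y \<in> carrier N} \<union>
      {e (x, y \<oplus>\<^bsub>N\<^esub> y') \<ominus>\<^bsub>F\<^esub> (e (x, y) \<oplus>\<^bsub>F\<^esub> e (x, y')) | x y y'.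
          x \<in> carrier M \<and> y \<in> carrier N \<and> y' \<in> carrier N} \<union>
      {e (r \<odot>\<^bsub>M\<^esub> x, y) \<ominus>\<^bsub>F\<^esub> r \<odot>\<^bsub>F\<^esub> e (x, y) | r x y.
          r \<in> carrier R \<and> x \<in> carrier M \<and> y \<in> carrier N} \<union>
      {e (x, r \<odot>\<^bsub>N\<^esub> y) \<ominus>\<^bsub>F\<^esub> r \<odot>\<^bsub>F\<^esub> e (x, y) | r x y.
          r \<in> carrier R \<and> x \<in> carrier M \<and> y \<in> carrier N})"

definition tensor_kernel ::
    "('a, 'r) ring_scheme \<Rightarrow> ('a, 'b, 'm) module_scheme \<Rightarrow> ('a, 'c, 'n) module_scheme
      \<Rightarrow> ('b \<times> 'c \<Rightarrow> 'a) set"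
  where "tensor_kernel R M N =
    submodule_generated R (free_module R (carrier M \<times> carrier N)) (tensor_relators R M N)"

definition tensor_product ::
    "('a, 'r) ring_scheme \<Rightarrow> ('a, 'b, 'm) module_scheme \<Rightarrow> ('a, 'c, 'n) module_scheme
      \<Rightarrow> ('a, ('a, 'b, 'c) tensor) module"
  where "tensor_product R M N =
    quotient_module (free_module R (carrier M \<times> carrier N)) (tensor_kernel R M N)"

definition pure_tensor ::
    "('a, 'r) ring_scheme \<Rightarrow> ('a, 'b, 'm) module_scheme \<Rightarrow> ('a, 'c, 'n) module_scheme
      \<Rightarrow> 'b \<Rightarrow> 'c \<Rightarrow> ('a, 'b, 'c) tensor"
  where "pure_tensor R M N x y =
    tensor_kernel R M N +>\<^bsub>free_module R (carrier M \<times> carrier N)\<^esub> free_gen R (x, y)"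

text \<open>For a bilinear map \<open>\<phi>\<close> from \<open>M \<times> N\<close> to \<open>P\<close>, this is the linear map from the tensor product
  of \<open>M\<close> and \<open>N\<close> to \<open>P\<close> that sends \<open>x \<otimes> y\<close> to \<open>\<phi> x y\<close>. Its value does not depend on the chosen
  representative, because \<open>\<phi>\<close> is bilinear; it is used for bilinear \<open>\<phi>\<close> only.\<close>

definition tensor_lift ::
    "('a, 'r) ring_scheme \<Rightarrow> ('a, 'b, 'm) module_scheme \<Rightarrow> ('a, 'c, 'n) module_scheme
      \<Rightarrow> ('a, 'd, 'p) module_scheme \<Rightarrow> ('b \<Rightarrow> 'c \<Rightarrow> 'd) \<Rightarrow> ('a, 'b, 'c) tensor \<Rightarrow> 'd"
  where "tensor_lift R M N P \<phi> T =
    (let u = (SOME u. u \<in> T) in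
      \<Oplus>\<^bsub>P\<^esub>s \<in> {s. u s \<noteq> \<zero>\<^bsub>R\<^esub>}. u s \<odot>\<^bsub>P\<^esub> \<phi> (fst s) (snd s))"

definition tensor_map ::
    "('a, 'r) ring_scheme \<Rightarrow> ('a, 'b, 'm) module_scheme \<Rightarrow> ('a, 'c, 'n) module_scheme
      \<Rightarrow> ('a, 'd, 'm2) module_scheme \<Rightarrow> ('a, 'e, 'n2) module_scheme
      \<Rightarrow> ('b \<Rightarrow> 'd) \<Rightarrow> ('c \<Rightarrow> 'e) \<Rightarrow> ('a, 'b, 'c) tensor \<Rightarrow> ('a, 'd, 'e) tensor"
  where "tensor_map R M N M' N' g h =
    tensor_lift R M N (tensor_product R M' N') (\<lambda>x y. pure_tensor R M' N' (g x) (h y))"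

text \<open>The canonical isomorphisms from \<open>(M \<otimes> N) \<otimes> P\<close> to \<open>M \<otimes> (N \<otimes> P)\<close>, from \<open>R \<otimes> M\<close> to \<open>M\<close>
  and from \<open>M \<otimes> R\<close> to \<open>M\<close>.\<close>

definition tensor_assoc ::
    "('a, 'r) ring_scheme \<Rightarrow> ('a, 'b, 'm) module_scheme \<Rightarrow> ('a, 'c, 'n) module_scheme
      \<Rightarrow> ('a, 'd, 'p) module_scheme
      \<Rightarrow> ('a, ('a, 'b, 'c) tensor, 'd) tensor \<Rightarrow> ('a, 'b, ('a, 'c, 'd) tensor) tensor"
  where "tensor_assoc R M N P =
    (let NP = tensor_product R N P; Q = tensor_product R M NP in
      tensor_lift R (tensor_product R M N) P Q
        (\<lambda>t z. tensor_lift R M N Q (\<lambda>x y. pure_tensor R M NP x (pure_tensor R N P y z)) t))"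

definition tensor_lunit ::
    "('a, 'r) ring_scheme \<Rightarrow> ('a, 'b, 'm) module_scheme \<Rightarrow> ('a, 'a, 'b) tensor \<Rightarrow> 'b"
  where "tensor_lunit R M = tensor_lift R (ring_as_module R) M M (\<lambda>r x. r \<odot>\<^bsub>M\<^esub> x)"

definition tensor_runit ::
    "('a, 'r) ring_scheme \<Rightarrow> ('a, 'b, 'm) module_scheme \<Rightarrow> ('a, 'b, 'a) tensor \<Rightarrow> 'b"
  where "tensor_runit R M = tensor_lift R M (ring_as_module R) M (\<lambda>x r. r \<odot>\<^bsub>M\<^esub> x)"

text \<open>Flatness: tensoring with \<open>C\<close> preserves injectivity of linear maps. HOL cannot quantify over
  the modules of all types inside a predicate, so the test modules have elements in one fixed type,
  that of sets of functions from \<open>nat\<close> to \<open>'a\<close>. Every finitely generated \<open>R\<close>-module is isomorphic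
  to one over this type (a quotient of a free module on \<open>{0..<n}\<close>), and so is every ideal of \<open>R\<close>.
  Since flatness can be tested on the inclusions of ideals into \<open>R\<close>, the restriction is harmless.\<close>

definition flat_module :: "('a, 'r) ring_scheme \<Rightarrow> ('a, 'c, 'm) module_scheme \<Rightarrow> bool"
  where "flat_module R C \<longleftrightarrow>
    module R C \<and>
    (\<forall>(N :: ('a, (nat \<Rightarrow> 'a) set) module) (N' :: ('a, (nat \<Rightarrow> 'a) set) module) g.
      module R N \<longrightarrow> module R N' \<longrightarrow> g \<in> linear_maps R N N' \<longrightarrow> inj_on g (carrier N) \<longrightarrow>
      inj_on (tensor_map R N C N' C g (\<lambda>c. c)) (carrier (tensor_product R N C)))"


section \<open>Coalgebras and comodules\<close>

record ('a, 'c) coalgebra = "('a, 'c) module" +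
  comult :: "'c \<Rightarrow> ('a, 'c, 'c) tensor"
  counit :: "'c \<Rightarrow> 'a"

locale coalgebra = module R C
  for R :: "('a, 'r) ring_scheme" and C :: "('a, 'c) coalgebra" +
  assumes comult_linear: "comult C \<in> linear_maps R C (tensor_product R C C)"
    and counit_linear: "counit C \<in> linear_maps R C (ring_as_module R)"
    and comult_coassoc: "c \<in> carrier C \<Longrightarrow>
      tensor_assoc R C C C
        (tensor_map R C C (tensor_product R C C) C (comult C) (\<lambda>x. x) (comult C c)) =
      tensor_map R C C C (tensor_product R C C) (\<lambda>x. x) (comult C) (comult C c)"
    and counit_left: "c \<in> carrier C \<Longrightarrow>
      tensor_lunit R C (tensor_map R C C (ring_as_module R) C (counit C) (\<lambda>x. x) (comult C c)) = c"
    and counit_right: "c \<in> carrier C \<Longrightarrow>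
      tensor_runit R C (tensor_map R C C C (ring_as_module R) (\<lambda>x. x) (counit C) (comult C c)) = c"

record ('a, 'b, 'c) comodule = "('a, 'b) module" +
  coaction :: "'b \<Rightarrow> ('a, 'b, 'c) tensor"

locale right_comodule = coalgebra R C + M: module R M
  for R :: "('a, 'r) ring_scheme" and C :: "('a, 'c) coalgebra" and M :: "('a, 'b, 'c) comodule" +
  assumes coaction_linear: "coaction M \<in> linear_maps R M (tensor_product R M C)"
    and coaction_coassoc: "m \<in> carrier M \<Longrightarrow>
      tensor_assoc R M C C
        (tensor_map R M C (tensor_product R M C) C (coaction M) (\<lambda>x. x) (coaction M m)) =
      tensor_map R M C M (tensor_product R C C) (\<lambda>x. x) (comult C) (coaction M m)"
    and coaction_counit: "m \<in> carrier M \<Longrightarrow>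
      tensor_runit R M (tensor_map R M C M (ring_as_module R) (\<lambda>x. x) (counit C) (coaction M m)) = m"

definition comodule_hom ::
    "('a, 'r) ring_scheme \<Rightarrow> ('a, 'c) coalgebra \<Rightarrow> ('a, 'b, 'c) comodule \<Rightarrow> ('a, 'd, 'c) comodule
      \<Rightarrow> ('b \<Rightarrow> 'd) set"
  where "comodule_hom R C M N =
    {g \<in> linear_maps R M N.
      \<forall>m\<in>carrier M. coaction N (g m) = tensor_map R M C N C g (\<lambda>c. c) (coaction M m)}"

definition comodule_iso ::
    "('a, 'r) ring_scheme \<Rightarrow> ('a, 'c) coalgebra \<Rightarrow> ('a, 'b, 'c) comodule \<Rightarrow> ('a, 'd, 'c) comodule
      \<Rightarrow> ('b \<Rightarrow> 'd) set"
  where "comodule_iso R C M N =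
    {g \<in> comodule_hom R C M N. \<exists>h\<in>comodule_hom R C N M.
      (\<forall>m\<in>carrier M. h (g m) = m) \<and> (\<forall>n\<in>carrier N. g (h n) = n)}"

definition comodule_End ::
    "('a, 'r) ring_scheme \<Rightarrow> ('a, 'c) coalgebra \<Rightarrow> ('a, 'b, 'c) comodule \<Rightarrow> ('b \<Rightarrow> 'b) ring"
  where "comodule_End R C M =
    \<lparr>carrier = comodule_hom R C M M \<inter> extensional (carrier M),
     mult = compose (carrier M), one = (\<lambda>m\<in>carrier M. m),
     zero = (\<lambda>m\<in>carrier M. \<zero>\<^bsub>M\<^esub>), add = (\<lambda>f g. \<lambda>m\<in>carrier M. f m \<oplus>\<^bsub>M\<^esub> g m)\<rparr>"

text \<open>That the inclusion is a comodule morphism forces the addition and scalar multiplication of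
  \<open>K\<close> to be those of \<open>M\<close>. Over a flat coalgebra the coaction of \<open>K\<close> is determined on \<open>carrier K\<close>
  as well.\<close>

definition subcomodule ::
    "('a, 'r) ring_scheme \<Rightarrow> ('a, 'c) coalgebra \<Rightarrow> ('a, 'b, 'c) comodule \<Rightarrow> ('a, 'b, 'c) comodule \<Rightarrow> bool"
  where "subcomodule R C K M \<longleftrightarrow>
    right_comodule R C K \<and> carrier K \<subseteq> carrier M \<and> (\<lambda>x. x) \<in> comodule_hom R C K M"

definition comodule_decomposition ::
    "('a, 'r) ring_scheme \<Rightarrow> ('a, 'c) coalgebra \<Rightarrow> ('a, 'b, 'c) comodule
      \<Rightarrow> ('a, 'b, 'c) comodule \<Rightarrow> ('a, 'b, 'c) comodule \<Rightarrow> bool"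
  where "comodule_decomposition R C M A B \<longleftrightarrow>
    subcomodule R C A M \<and> subcomodule R C B M \<and>
    carrier A <+>\<^bsub>M\<^esub> carrier B = carrier M \<and> carrier A \<inter> carrier B = {\<zero>\<^bsub>M\<^esub>}"


section \<open>Clean elements of a ring\<close>

definition clean_element :: "('a, 'r) ring_scheme \<Rightarrow> 'a \<Rightarrow> bool"
  where "clean_element E f \<longleftrightarrow>
    (\<exists>u\<in>Units E. \<exists>e\<in>carrier E. e \<otimes>\<^bsub>E\<^esub> e = e \<and> f = u \<oplus>\<^bsub>E\<^esub> e)"

end

theory Submission
  imports Defs
begin

text \<open>If \<open>f = u + e\<close> with \<open>u\<close> a unit and \<open>e\<close> idempotent, then \<open>f\<close> agrees with \<open>u\<close> on the image \<open>A\<close> of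
  \<open>1 - e\<close>, and \<open>1 - f\<close> agrees with \<open>-u\<close> on the image \<open>B\<close> of \<open>e\<close>; so \<open>X = u A\<close> and \<open>Y = u B\<close>, the images
  of \<open>u (1 - e) u\<^sup>-\<^sup>1\<close> and \<open>u e u\<^sup>-\<^sup>1\<close>, do the job. The image of an idempotent endomorphism \<open>p\<close> is a
  subcomodule with coaction \<open>(p \<otimes> 1) \<circ> \<rho>\<close>. Conversely, take for \<open>e\<close> the projection onto \<open>B\<close> along \<open>A\<close>;
  then \<open>u = f - e\<close> maps \<open>a + b\<close> to \<open>f a - (1 - f) b\<close>, which is a bijection from \<open>A \<oplus> B\<close> to
  \<open>X \<oplus> Y\<close>, and the inverse of a bijective comodule morphism is a comodule morphism.\<close>


section \<open>Linear maps\<close>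

text \<open>The obstacle is that a subcomodule \<open>K\<close> has its own tensor product:
  \<open>K \<otimes> C\<close> is a set of cosets in another free module than
  \<open>M \<otimes> C\<close>, so the coaction of \<open>K\<close> is not simply a restriction of
  that of \<open>M\<close>, and the two are compared only through \<open>tensor_map\<close> of the
  inclusion. Moreover \<open>tensor_lift\<close> evaluates at a chosen representative. This is why
  the universal property, the functoriality of \<open>tensor_map\<close> and the naturality of
  \<open>tensor_assoc\<close> and \<open>tensor_runit\<close> are needed; with them every identity
  is checked on pure tensors. In the converse the summands are arbitrary comodule records with
  coactions of their own, tied to \<open>M\<close> only by the inclusions being comodule morphisms.
  That is enough, because a linear map that is a comodule morphism on both summands is one on
  \<open>M\<close>; this is how the projection becomes an element of the endomorphism ring. The
  difference \<open>1 - f\<close> is formed in that ring, whose elements are extensional functions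
  and whose negatives are given by a description operator, so it has to be evaluated pointwise
  before it can be compared with \<open>-u\<close>.\<close>

lemma linear_mapsI:
  assumes "\<And>x. x \<in> carrier M \<Longrightarrow> g x \<in> carrier N"
    and "\<And>x y. x \<in> carrier M \<Longrightarrow> y \<in> carrier M \<Longrightarrow> g (x \<oplus>\<^bsub>M\<^esub> y) = g x \<oplus>\<^bsub>N\<^esub> g y"
    and "\<And>r x. r \<in> carrier R \<Longrightarrow> x \<in> carrier M \<Longrightarrow> g (r \<odot>\<^bsub>M\<^esub> x) = r \<odot>\<^bsub>N\<^esub> g x"
  shows "g \<in> linear_maps R M N"
  using assms by (auto simp: linear_maps_def)

lemma linear_mapsD:
  assumes "g \<in> linear_maps R M N"
  shows linear_maps_closed: "x \<in> carrier M \<Longrightarrow> g x \<in> carrier N"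
    and linear_maps_add: "x \<in> carrier M \<Longrightarrow> y \<in> carrier M \<Longrightarrow> g (x \<oplus>\<^bsub>M\<^esub> y) = g x \<oplus>\<^bsub>N\<^esub> g y"
    and linear_maps_smult: "r \<in> carrier R \<Longrightarrow> x \<in> carrier M \<Longrightarrow> g (r \<odot>\<^bsub>M\<^esub> x) = r \<odot>\<^bsub>N\<^esub> g x"
  using assms by (auto simp: linear_maps_def)

lemma linear_maps_id: "(\<lambda>x. x) \<in> linear_maps R M M"
  by (simp add: linear_maps_def)

lemma linear_maps_comp:
  assumes "g \<in> linear_maps R M N" "h \<in> linear_maps R N P"
  shows "(\<lambda>x. h (g x)) \<in> linear_maps R M P"
  by (rule linear_mapsI) (simp_all add: linear_mapsD[OF assms(1)] linear_mapsD[OF assms(2)])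

lemma linear_maps_abelian_group_hom:
  assumes "module R M" "module R N" "g \<in> linear_maps R M N"
  shows "abelian_group_hom M N g"
proof -
  interpret M: module R M by fact
  interpret N: module R N by fact
  show ?thesis
    using assms(3)
    by (intro abelian_group_homI group_hom.intro group_hom_axioms.intro)
      (auto simp: M.abelian_group_axioms N.abelian_group_axioms M.add.group_axioms N.add.group_axioms
        hom_def linear_maps_def)
qed

lemma linear_maps_zero:
  "module R M \<Longrightarrow> module R N \<Longrightarrow> g \<in> linear_maps R M N \<Longrightarrow> g \<zero>\<^bsub>M\<^esub> = \<zero>\<^bsub>N\<^esub>"
  by (rule abelian_group_hom.hom_zero[OF linear_maps_abelian_group_hom])

lemma linear_maps_uminus:
  "module R M \<Longrightarrow> module R N \<Longrightarrow> g \<in> linear_maps R M N \<Longrightarrow> x \<in> carrier M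
    \<Longrightarrow> g (\<ominus>\<^bsub>M\<^esub> x) = \<ominus>\<^bsub>N\<^esub> g x"
  by (rule abelian_group_hom.hom_a_inv[OF linear_maps_abelian_group_hom])

lemma module_cring: "module R M \<Longrightarrow> cring R"
  by (simp add: module_def)

lemma linear_maps_minus:
  assumes "module R M" "module R N" "g \<in> linear_maps R M N" "x \<in> carrier M" "y \<in> carrier M"
  shows "g (x \<ominus>\<^bsub>M\<^esub> y) = g x \<ominus>\<^bsub>N\<^esub> g y"
proof -
  interpret M: module R M by fact
  show ?thesis
    using assms by (simp add: a_minus_def linear_maps_add linear_maps_uminus)
qed

text \<open>Used to see that a linear map which kills a set of relators kills the submodule they
  generate.\<close>

lemma linear_maps_kernel_submodule:
  assumes "module R M" "module R N" "g \<in> linear_maps R M N"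
  shows "submodule {x \<in> carrier M. g x = \<zero>\<^bsub>N\<^esub>} R M"
proof -
  interpret M: module R M by fact
  interpret N: module R N by fact
  show ?thesis
    by (rule M.submoduleI)
      (auto simp: linear_maps_zero[OF assms] linear_maps_uminus[OF assms] linear_mapsD[OF assms(3)])
qed


section \<open>Free modules\<close>

lemma free_module_simps [simp]:
  "\<zero>\<^bsub>free_module R S\<^esub> = (\<lambda>s. \<zero>\<^bsub>R\<^esub>)"
  "u \<oplus>\<^bsub>free_module R S\<^esub> v = (\<lambda>s. u s \<oplus>\<^bsub>R\<^esub> v s)"
  "r \<odot>\<^bsub>free_module R S\<^esub> u = (\<lambda>s. r \<otimes>\<^bsub>R\<^esub> u s)"
  by (simp_all add: free_module_def)

lemma free_module_carrier:
  "u \<in> carrier (free_module R S) \<longleftrightarrow>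
    (\<forall>s. u s \<in> carrier R) \<and> (\<forall>s. s \<notin> S \<longrightarrow> u s = \<zero>\<^bsub>R\<^esub>) \<and> finite {s. u s \<noteq> \<zero>\<^bsub>R\<^esub>}"
  by (simp add: free_module_def)

lemma free_module_closed: "u \<in> carrier (free_module R S) \<Longrightarrow> u s \<in> carrier R"
  by (simp add: free_module_carrier)

lemma (in cring) free_module_add_closed:
  assumes "u \<in> carrier (free_module R S)" "v \<in> carrier (free_module R S)"
  shows "(\<lambda>s. u s \<oplus> v s) \<in> carrier (free_module R S)"
proof -
  have "{s. u s \<oplus> v s \<noteq> \<zero>} \<subseteq> {s. u s \<noteq> \<zero>} \<union> {s. v s \<noteq> \<zero>}"
    by auto
  with assms show ?thesis
    by (auto simp: free_module_carrier intro: finite_subset)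
qed

lemma (in cring) free_module_smult_closed:
  assumes "r \<in> carrier R" "u \<in> carrier (free_module R S)"
  shows "(\<lambda>s. r \<otimes> u s) \<in> carrier (free_module R S)"
proof -
  have "{s. r \<otimes> u s \<noteq> \<zero>} \<subseteq> {s. u s \<noteq> \<zero>}"
    using assms by auto
  with assms show ?thesis
    by (auto simp: free_module_carrier intro: finite_subset)
qed

lemma (in cring) free_module_module: "module R (free_module R S)"
proof (rule moduleI)
  show "abelian_group (free_module R S)"
  proof (rule abelian_groupI; clarsimp?)
    fix u assume "u \<in> carrier (free_module R S)"
    \<comment> \<open>The negative is taken as \<open>(-1) u\<close>, so that closure under scalars
      also settles its finite support.\<close>
    then show "\<exists>v\<in>carrier (free_module R S). (\<lambda>s. v s \<oplus> u s) = (\<lambda>s. \<zero>)"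
      using free_module_smult_closed[of "\<ominus> \<one>" u S]
      by (intro bexI[of _ "\<lambda>s. (\<ominus> \<one>) \<otimes> u s"]) (auto simp: free_module_closed l_minus l_neg)
  qed (auto simp: free_module_add_closed a_assoc a_comm[OF free_module_closed free_module_closed]
      free_module_closed[THEN a_assoc, OF _ free_module_closed free_module_closed] free_module_closed
      free_module_carrier[of "\<lambda>s. \<zero>"])
qed (auto simp: free_module_smult_closed free_module_closed l_distr r_distr m_assoc is_cring)

lemma (in cring) free_gen_closed: "s \<in> S \<Longrightarrow> free_gen R s \<in> carrier (free_module R S)"
  by (auto simp: free_gen_def free_module_carrier)

text \<open>Induction over a finite set that contains the support, splitting off one coordinate at a
  time. It replaces the expansion of \<open>u\<close> as a finite sum of multiples of
  generators.\<close>

lemma (in cring) free_module_induct [consumes 1, case_names zero gen]: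
  assumes "u \<in> carrier (free_module R S)"
    and "P (\<lambda>s. \<zero>)"
    and gen: "\<And>u r s. u \<in> carrier (free_module R S) \<Longrightarrow> r \<in> carrier R \<Longrightarrow> s \<in> S \<Longrightarrow> P u \<Longrightarrow>
      P (\<lambda>t. u t \<oplus> r \<otimes> free_gen R s t)"
  shows "P u"
proof -
  have "P u" if "finite A" "u \<in> carrier (free_module R S)" "{s. u s \<noteq> \<zero>} \<subseteq> A" for A u
    using that
  proof (induction A arbitrary: u rule: finite_induct)
    case empty
    then have "u = (\<lambda>s. \<zero>)" by auto
    then show ?case using assms(2) by simp
  next
    case (insert a A)
    define v where "v = u(a := \<zero>)"
    have v: "v \<in> carrier (free_module R S)"
      using insert.prems(1) insert.hyps(1)
      by (auto simp: v_def free_module_carrier intro: rev_finite_subset)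
    have "{s. v s \<noteq> \<zero>} \<subseteq> A"
      using insert.prems by (auto simp: v_def)
    then have "P v" by (rule insert.IH[OF v])
    show ?case
    proof (cases "a \<in> S")
      case True
      have "P (\<lambda>t. v t \<oplus> u a \<otimes> free_gen R a t)"
        using v \<open>P v\<close> True insert.prems(1) by (intro gen) (auto simp: free_module_closed)
      moreover have "(\<lambda>t. v t \<oplus> u a \<otimes> free_gen R a t) = u"
        using insert.prems(1) by (auto simp: v_def free_gen_def free_module_closed)
      ultimately show ?thesis by simp
    next
      \<comment> \<open>Outside \<open>S\<close> the value \<open>u a\<close> is already zero, so
        nothing was removed.\<close>
      case False
      then have "v = u" using insert.prems(1) by (auto simp: v_def free_module_carrier)
      with \<open>P v\<close> show ?thesis by simp
    qed
  qed
  with assms(1) show ?thesis by (auto simp: free_module_carrier)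
qed

text \<open>The linear extension of \<phi> from the basis. It is the sum formed by
  \<open>tensor_lift\<close>, with the representative \<open>u\<close> made explicit, so that
  linearity can be proved before any choice enters.\<close>

definition free_lift ::
    "('a, 'r) ring_scheme \<Rightarrow> ('a, 'b, 'm) module_scheme \<Rightarrow> ('s \<Rightarrow> 'b) \<Rightarrow> ('s \<Rightarrow> 'a) \<Rightarrow> 'b"
  where "free_lift R P \<phi> u = (\<Oplus>\<^bsub>P\<^esub>s \<in> {s. u s \<noteq> \<zero>\<^bsub>R\<^esub>}. u s \<odot>\<^bsub>P\<^esub> \<phi> s)"

text \<open>The support depends on \<open>u\<close>; a common finite index set allows two such sums
  to be added term by term. The additional terms have coefficient zero.\<close>

lemma (in module) free_lift_superset:
  assumes "u \<in> carrier (free_module R S)" "\<phi> \<in> S \<rightarrow> carrier M"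
    and "finite A" "{s. u s \<noteq> \<zero>} \<subseteq> A" "A \<subseteq> S"
  shows "free_lift R M \<phi> u = (\<Oplus>\<^bsub>M\<^esub>s \<in> A. u s \<odot>\<^bsub>M\<^esub> \<phi> s)"
  unfolding free_lift_def
  using assms by (intro M.add.finprod_mono_neutral_cong_left) (auto simp: free_module_closed Pi_def)

lemma (in module) free_lift_linear:
  assumes \<phi>: "\<phi> \<in> S \<rightarrow> carrier M"
  shows "free_lift R M \<phi> \<in> linear_maps R (free_module R S) M"
proof (rule linear_mapsI; (simp only: free_module_simps)?)
  fix u assume u: "u \<in> carrier (free_module R S)"
  then have uS: "finite {s. u s \<noteq> \<zero>}" "{s. u s \<noteq> \<zero>} \<subseteq> S"
    by (auto simp: free_module_carrier)
  show "free_lift R M \<phi> u \<in> carrier M"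
    unfolding free_lift_def using u uS \<phi>
    by (intro M.finsum_closed) (auto simp: free_module_closed Pi_def subset_iff)
  {
    fix v assume v: "v \<in> carrier (free_module R S)"
    then have vS: "finite {s. v s \<noteq> \<zero>}" "{s. v s \<noteq> \<zero>} \<subseteq> S"
      by (auto simp: free_module_carrier)
    define A where "A = {s. u s \<noteq> \<zero>} \<union> {s. v s \<noteq> \<zero>}"
    have A: "finite A" "A \<subseteq> S" using uS vS by (auto simp: A_def)
    have "free_lift R M \<phi> (\<lambda>s. u s \<oplus> v s) = (\<Oplus>\<^bsub>M\<^esub>s \<in> A. (u s \<oplus> v s) \<odot>\<^bsub>M\<^esub> \<phi> s)"
      using A by (intro free_lift_superset[OF _ \<phi>] R.free_module_add_closed u v) (auto simp: A_def)
    also have "\<dots> = (\<Oplus>\<^bsub>M\<^esub>s \<in> A. u s \<odot>\<^bsub>M\<^esub> \<phi> s \<oplus>\<^bsub>M\<^esub> v s \<odot>\<^bsub>M\<^esub> \<phi> s)"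
      using A \<phi> u v
      by (intro M.finsum_cong') (auto simp: smult_l_distr free_module_closed Pi_def subset_iff)
    also have "\<dots> = (\<Oplus>\<^bsub>M\<^esub>s \<in> A. u s \<odot>\<^bsub>M\<^esub> \<phi> s) \<oplus>\<^bsub>M\<^esub> (\<Oplus>\<^bsub>M\<^esub>s \<in> A. v s \<odot>\<^bsub>M\<^esub> \<phi> s)"
      using A \<phi> u v by (intro M.finsum_addf) (auto simp: free_module_closed Pi_def subset_iff)
    also have "\<dots> = free_lift R M \<phi> u \<oplus>\<^bsub>M\<^esub> free_lift R M \<phi> v"
      using A free_lift_superset[OF u \<phi>, of A] free_lift_superset[OF v \<phi>, of A]
      by (simp add: A_def)
    finally show "free_lift R M \<phi> (\<lambda>s. u s \<oplus> v s) = free_lift R M \<phi> u \<oplus>\<^bsub>M\<^esub> free_lift R M \<phi> v" .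
  }
  {
    fix r assume r: "r \<in> carrier R"
    \<comment> \<open>Scaling can shrink the support, so that of \<open>u\<close> serves as index
      set for both sides.\<close>
    have "free_lift R M \<phi> (\<lambda>s. r \<otimes> u s) = (\<Oplus>\<^bsub>M\<^esub>s \<in> {s. u s \<noteq> \<zero>}. (r \<otimes> u s) \<odot>\<^bsub>M\<^esub> \<phi> s)"
      using uS r by (intro free_lift_superset[OF _ \<phi>] R.free_module_smult_closed u) auto
    also have "\<dots> = (\<Oplus>\<^bsub>M\<^esub>s \<in> {s. u s \<noteq> \<zero>}. r \<odot>\<^bsub>M\<^esub> (u s \<odot>\<^bsub>M\<^esub> \<phi> s))"
      using uS \<phi> u r
      by (intro M.finsum_cong') (auto simp: smult_assoc1 free_module_closed Pi_def subset_iff)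
    also have "\<dots> = r \<odot>\<^bsub>M\<^esub> free_lift R M \<phi> u"
      unfolding free_lift_def using uS \<phi> u r
      by (intro finsum_smult_ldistr[symmetric]) (auto simp: free_module_closed Pi_def subset_iff)
    finally show "free_lift R M \<phi> (\<lambda>s. r \<otimes> u s) = r \<odot>\<^bsub>M\<^esub> free_lift R M \<phi> u" .
  }
qed

lemma (in module) free_lift_gen:
  assumes "\<phi> \<in> S \<rightarrow> carrier M" "s \<in> S"
  shows "free_lift R M \<phi> (free_gen R s) = \<phi> s"
proof -
  have "free_lift R M \<phi> (free_gen R s) = (\<Oplus>\<^bsub>M\<^esub>t \<in> {s}. free_gen R s t \<odot>\<^bsub>M\<^esub> \<phi> t)"
    using assms by (intro free_lift_superset R.free_gen_closed) (auto simp: free_gen_def)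
  with assms show ?thesis by (auto simp: free_gen_def Pi_def)
qed


section \<open>Quotient modules\<close>

lemma (in module) submodule_generated_submodule:
  assumes "S \<subseteq> carrier M"
  shows "submodule (submodule_generated R M S) R M"
proof -
  \<comment> \<open>This member keeps the intersection inside the carrier; an empty family would
    give the whole type.\<close>
  have "carrier M \<in> {H. submodule H R M \<and> S \<subseteq> H}"
    using assms carrier_is_submodule by auto
  then show ?thesis
    unfolding submodule_generated_def
    using submodule.axioms(1)[THEN subgroup.one_closed]
    by (intro submoduleI) (auto simp: submoduleE)
qed

lemma submodule_generated_least:
  "submodule H R M \<Longrightarrow> S \<subseteq> H \<Longrightarrow> submodule_generated R M S \<subseteq> H"
  by (auto simp: submodule_generated_def)

lemma submodule_generated_superset: "S \<subseteq> submodule_generated R M S"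
  by (auto simp: submodule_generated_def)

lemma (in module) submodule_abelian_subgroup:
  "submodule H R M \<Longrightarrow> abelian_subgroup H M"
  by (intro abelian_subgroupI3 additive_subgroup.intro submodule.axioms(1)) (auto simp: M.abelian_group_axioms)

lemma quotient_module_sel [simp]:
  "carrier (quotient_module M H) = a_rcosets\<^bsub>M\<^esub> H"
  "zero (quotient_module M H) = H"
  "add (quotient_module M H) = set_add M"
  by (simp_all add: quotient_module_def)

lemma a_rcosetsE:
  assumes "T \<in> a_rcosets\<^bsub>M\<^esub> H"
  obtains x where "x \<in> carrier M" "T = H +>\<^bsub>M\<^esub> x"
  using assms by (auto simp: A_RCOSETS_def RCOSETS_def a_r_coset_def)

text \<open>The scalar action is a union over all representatives. Two of them differ by some
  \<open>h\<close> in \<open>H\<close>, and \<open>r h\<close> is again in \<open>H\<close>, so all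
  cosets in the union coincide.\<close>

lemma (in module) quotient_module_smult:
  assumes H: "submodule H R M" and r: "r \<in> carrier R" and x: "x \<in> carrier M"
  shows "r \<odot>\<^bsub>quotient_module M H\<^esub> (H +>\<^bsub>M\<^esub> x) = H +>\<^bsub>M\<^esub> (r \<odot>\<^bsub>M\<^esub> x)"
proof -
  interpret H: abelian_subgroup H M by (rule submodule_abelian_subgroup[OF H])
  have "H +>\<^bsub>M\<^esub> (r \<odot>\<^bsub>M\<^esub> y) = H +>\<^bsub>M\<^esub> (r \<odot>\<^bsub>M\<^esub> x)" if y: "y \<in> H +>\<^bsub>M\<^esub> x" for y
  proof -
    obtain h where h: "h \<in> H" "y = h \<oplus>\<^bsub>M\<^esub> x"
      using y by (auto simp: a_r_coset_def')
    then have hM: "h \<in> carrier M" using H.a_subset by auto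
    have "r \<odot>\<^bsub>M\<^esub> y = r \<odot>\<^bsub>M\<^esub> h \<oplus>\<^bsub>M\<^esub> r \<odot>\<^bsub>M\<^esub> x"
      using h hM r x by (simp add: smult_r_distr)
    moreover have "r \<odot>\<^bsub>M\<^esub> h \<in> H" using submodule.smult_closed[OF H r h(1)] .
    ultimately have "r \<odot>\<^bsub>M\<^esub> y \<in> H +>\<^bsub>M\<^esub> (r \<odot>\<^bsub>M\<^esub> x)"
      by (auto simp: a_r_coset_def')
    then show ?thesis
      using H.a_repr_independence' r x by simp
  qed
  then have "(\<Union>y\<in>H +>\<^bsub>M\<^esub> x. H +>\<^bsub>M\<^esub> (r \<odot>\<^bsub>M\<^esub> y)) = (\<Union>y\<in>H +>\<^bsub>M\<^esub> x. H +>\<^bsub>M\<^esub> (r \<odot>\<^bsub>M\<^esub> x))"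
    by simp
  \<comment> \<open>The union of a constant family collapses because the index coset contains
    \<open>x\<close>.\<close>
  also have "\<dots> = H +>\<^bsub>M\<^esub> (r \<odot>\<^bsub>M\<^esub> x)"
    using H.a_rcos_self[OF x] by blast
  finally show ?thesis
    by (simp add: quotient_module_def)
qed

lemma (in module) quotient_module_add:
  assumes "submodule H R M" "x \<in> carrier M" "y \<in> carrier M"
  shows "(H +>\<^bsub>M\<^esub> x) \<oplus>\<^bsub>quotient_module M H\<^esub> (H +>\<^bsub>M\<^esub> y) = H +>\<^bsub>M\<^esub> (x \<oplus>\<^bsub>M\<^esub> y)"
  using abelian_subgroup.a_rcos_sum[OF submodule_abelian_subgroup[OF assms(1)] assms(2,3)] by simp

lemma (in abelian_group) a_rcosets_memI: "x \<in> carrier G \<Longrightarrow> H +> x \<in> a_rcosets H"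
  by (auto simp: A_RCOSETS_def RCOSETS_def a_r_coset_def)

lemma (in module) quotient_module_module:
  assumes H: "submodule H R M"
  shows "module R (quotient_module M H)"
proof (rule moduleI)
  interpret H: abelian_subgroup H M by (rule submodule_abelian_subgroup[OF H])
  show "abelian_group (quotient_module M H)"
  proof (rule abelian_groupI)
    fix T assume "T \<in> carrier (quotient_module M H)"
    then show "\<exists>U\<in>carrier (quotient_module M H). U \<oplus>\<^bsub>quotient_module M H\<^esub> T = \<zero>\<^bsub>quotient_module M H\<^esub>"
      by (auto intro!: bexI[of _ "a_set_inv\<^bsub>M\<^esub> T"] H.a_rcosets_inv_mult_group_eq H.a_setinv_closed)
  qed (auto elim!: a_rcosetsE simp: H.a_setmult_closed H.a_subgroup_in_rcosets H.rcosets_add_eq H.a_rcosets_assoc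
      H.a_rcos_sum M.a_comm M.a_assoc M.a_rcosets_memI)
qed (auto elim!: a_rcosetsE
    simp: quotient_module_smult[OF H] quotient_module_add[OF H, simplified] M.a_rcosets_memI
      smult_l_distr smult_r_distr smult_assoc1 R.is_cring)

lemma (in module) quotient_module_proj_linear:
  assumes "submodule H R M"
  shows "(\<lambda>x. H +>\<^bsub>M\<^esub> x) \<in> linear_maps R M (quotient_module M H)"
  by (rule linear_mapsI)
    (simp_all add: quotient_module_smult[OF assms] quotient_module_add[OF assms, simplified] M.a_rcosets_memI)


section \<open>Tensor products\<close>

text \<open>Linearity is demanded only at arguments in the carriers, since the maps are total
  functions with arbitrary values elsewhere.\<close>

definition bilinear_map ::
    "('a, 'r) ring_scheme \<Rightarrow> ('a, 'b, 'm) module_scheme \<Rightarrow> ('a, 'c, 'n) module_scheme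
      \<Rightarrow> ('a, 'd, 'p) module_scheme \<Rightarrow> ('b \<Rightarrow> 'c \<Rightarrow> 'd) \<Rightarrow> bool"
  where "bilinear_map R M N P \<phi> \<longleftrightarrow>
    (\<forall>x\<in>carrier M. \<phi> x \<in> linear_maps R N P) \<and>
    (\<forall>y\<in>carrier N. (\<lambda>x. \<phi> x y) \<in> linear_maps R M P)"

lemma bilinear_mapI:
  assumes "\<And>x. x \<in> carrier M \<Longrightarrow> \<phi> x \<in> linear_maps R N P"
    and "\<And>y. y \<in> carrier N \<Longrightarrow> (\<lambda>x. \<phi> x y) \<in> linear_maps R M P"
  shows "bilinear_map R M N P \<phi>"
  using assms by (simp add: bilinear_map_def)

lemma bilinear_map_linear:
  assumes "bilinear_map R M N P \<phi>"
  shows "x \<in> carrier M \<Longrightarrow> \<phi> x \<in> linear_maps R N P"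
    and "y \<in> carrier N \<Longrightarrow> (\<lambda>x. \<phi> x y) \<in> linear_maps R M P"
  using assms by (auto simp: bilinear_map_def)

lemma bilinear_map_comp:
  assumes "bilinear_map R M' N' P \<phi>" "g \<in> linear_maps R M M'" "h \<in> linear_maps R N N'"
  shows "bilinear_map R M N P (\<lambda>x y. \<phi> (g x) (h y))"
  using assms(2,3)
  by (intro bilinear_mapI linear_maps_comp[OF _ bilinear_map_linear(1)[OF assms(1)]]
      linear_maps_comp[OF _ bilinear_map_linear(2)[OF assms(1)]]) (simp_all add: linear_maps_closed)

lemma (in abelian_group) a_minus_eq_zero:
  assumes "x \<in> carrier G" "y \<in> carrier G"
  shows "x \<ominus> y = \<zero> \<longleftrightarrow> x = y"
  using assms by (metis a_minus_def minus_equality r_neg minus_minus a_inv_closed)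

lemma (in module) a_rcos_eqI:
  assumes H: "submodule H R M" and x: "x \<in> carrier M" and y: "y \<in> carrier M" and "x \<ominus>\<^bsub>M\<^esub> y \<in> H"
  shows "H +>\<^bsub>M\<^esub> x = H +>\<^bsub>M\<^esub> y"
proof -
  interpret H: abelian_subgroup H M by (rule submodule_abelian_subgroup[OF H])
  have "x = (x \<ominus>\<^bsub>M\<^esub> y) \<oplus>\<^bsub>M\<^esub> y"
    using x y by (simp add: a_minus_def M.a_assoc M.l_neg)
  then have "x \<in> H +>\<^bsub>M\<^esub> y"
    using assms(4) by (auto simp: a_r_coset_def')
  then show ?thesis
    using H.a_repr_independence' y by simp
qed

section \<open>The tensor product as a quotient, and its generation by pure tensors\<close>

lemma (in module) relators_closed:
  assumes "module R N"
  shows "tensor_relators R M N \<subseteq> carrier (free_module R (carrier M \<times> carrier N))"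
proof -
  interpret N: module R N by fact
  interpret F: module R "free_module R (carrier M \<times> carrier N)" by (rule R.free_module_module)
  show ?thesis
    unfolding tensor_relators_def Let_def
    by (auto simp del: free_module_simps intro!: F.minus_closed F.a_closed F.smult_closed R.free_gen_closed)
qed

lemma tensor_kernel_submodule:
  assumes "module R M" "module R N"
  shows "submodule (tensor_kernel R M N) R (free_module R (carrier M \<times> carrier N))"
proof -
  interpret module R M by fact
  show ?thesis
    unfolding tensor_kernel_def
    by (rule module.submodule_generated_submodule[OF R.free_module_module relators_closed[OF assms(2)]])
qed

lemma tensor_product_module:
  assumes "module R M" "module R N"
  shows "module R (tensor_product R M N)"
  unfolding tensor_product_def
  by (rule module.quotient_module_module[OF cring.free_module_module[OF module_cring[OF assms(1)]]
        tensor_kernel_submodule[OF assms]])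

lemma tensor_product_proj_linear:
  assumes "module R M" "module R N"
  shows "(\<lambda>u. tensor_kernel R M N +>\<^bsub>free_module R (carrier M \<times> carrier N)\<^esub> u)
    \<in> linear_maps R (free_module R (carrier M \<times> carrier N)) (tensor_product R M N)"
  unfolding tensor_product_def
  by (rule module.quotient_module_proj_linear[OF cring.free_module_module[OF module_cring[OF assms(1)]]
        tensor_kernel_submodule[OF assms]])

text \<open>Each of the four families of relators is one of the four laws of bilinearity, read
  modulo \<open>tensor_kernel\<close>.\<close>

lemma pure_tensor_bilinear:
  assumes "module R M" "module R N"
  shows "bilinear_map R M N (tensor_product R M N) (pure_tensor R M N)"
proof -
  interpret M: module R M by fact
  interpret N: module R N by fact
  let ?F = "free_module R (carrier M \<times> carrier N)" and ?K = "tensor_kernel R M N"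
  let ?T = "tensor_product R M N" and ?e = "free_gen R"
  interpret F: module R ?F by (rule M.R.free_module_module)
  have K: "submodule ?K R ?F" by (rule tensor_kernel_submodule[OF assms])
  have rel: "w \<in> ?K" if "w \<in> tensor_relators R M N" for w
    using that unfolding tensor_kernel_def by (rule subsetD[OF submodule_generated_superset])
  note lin = linear_mapsD[OF tensor_product_proj_linear[OF assms]]
  have e: "?e (x, y) \<in> carrier ?F" if "x \<in> carrier M" "y \<in> carrier N" for x y
    using that by (intro M.R.free_gen_closed) auto
  have eq: "?K +>\<^bsub>?F\<^esub> u = ?K +>\<^bsub>?F\<^esub> v"
    if "u \<ominus>\<^bsub>?F\<^esub> v \<in> tensor_relators R M N" "u \<in> carrier ?F" "v \<in> carrier ?F" for u v
    by (rule F.a_rcos_eqI[OF K that(2,3) rel[OF that(1)]])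
  show ?thesis
  proof (intro bilinear_mapI linear_mapsI)
    fix x y assume xy: "x \<in> carrier M" "y \<in> carrier N"
    show "pure_tensor R M N x y \<in> carrier ?T" "pure_tensor R M N x y \<in> carrier ?T"
      unfolding pure_tensor_def by (auto intro!: lin(1) e xy)
    {
      fix y' assume y': "y' \<in> carrier N"
      have "?K +>\<^bsub>?F\<^esub> ?e (x, y \<oplus>\<^bsub>N\<^esub> y') = ?K +>\<^bsub>?F\<^esub> (?e (x, y) \<oplus>\<^bsub>?F\<^esub> ?e (x, y'))"
        using xy y' by (intro eq F.a_closed e N.a_closed) (auto simp: tensor_relators_def Let_def simp del: free_module_simps)
      then show "pure_tensor R M N x (y \<oplus>\<^bsub>N\<^esub> y') = pure_tensor R M N x y \<oplus>\<^bsub>?T\<^esub> pure_tensor R M N x y'"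
        unfolding pure_tensor_def by (simp only: lin(2)[OF e e] xy y')
    }
    {
      fix x' assume x': "x' \<in> carrier M"
      have "?K +>\<^bsub>?F\<^esub> ?e (x \<oplus>\<^bsub>M\<^esub> x', y) = ?K +>\<^bsub>?F\<^esub> (?e (x, y) \<oplus>\<^bsub>?F\<^esub> ?e (x', y))"
        using xy x' by (intro eq F.a_closed e M.a_closed) (auto simp: tensor_relators_def Let_def simp del: free_module_simps)
      then show "pure_tensor R M N (x \<oplus>\<^bsub>M\<^esub> x') y = pure_tensor R M N x y \<oplus>\<^bsub>?T\<^esub> pure_tensor R M N x' y"
        unfolding pure_tensor_def by (simp only: lin(2)[OF e e] xy x')
    }
    fix r assume r: "r \<in> carrier R"
    have "?K +>\<^bsub>?F\<^esub> ?e (r \<odot>\<^bsub>M\<^esub> x, y) = ?K +>\<^bsub>?F\<^esub> (r \<odot>\<^bsub>?F\<^esub> ?e (x, y))"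
      using xy r by (intro eq F.smult_closed e M.smult_closed) (auto simp: tensor_relators_def Let_def simp del: free_module_simps)
    then show "pure_tensor R M N (r \<odot>\<^bsub>M\<^esub> x) y = r \<odot>\<^bsub>?T\<^esub> pure_tensor R M N x y"
      unfolding pure_tensor_def by (simp only: lin(3)[OF r e] xy)
    have "?K +>\<^bsub>?F\<^esub> ?e (x, r \<odot>\<^bsub>N\<^esub> y) = ?K +>\<^bsub>?F\<^esub> (r \<odot>\<^bsub>?F\<^esub> ?e (x, y))"
      using xy r by (intro eq F.smult_closed e N.smult_closed) (auto simp: tensor_relators_def Let_def simp del: free_module_simps)
    then show "pure_tensor R M N x (r \<odot>\<^bsub>N\<^esub> y) = r \<odot>\<^bsub>?T\<^esub> pure_tensor R M N x y"
      unfolding pure_tensor_def by (simp only: lin(3)[OF r e] xy)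
  qed
qed

lemma pure_tensor_closed:
  "module R M \<Longrightarrow> module R N \<Longrightarrow> x \<in> carrier M \<Longrightarrow> y \<in> carrier N
    \<Longrightarrow> pure_tensor R M N x y \<in> carrier (tensor_product R M N)"
  by (blast intro: linear_maps_closed[OF bilinear_map_linear(1)[OF pure_tensor_bilinear]])

lemma tensor_product_carrierE:
  assumes "t \<in> carrier (tensor_product R M N)"
  obtains u where "u \<in> carrier (free_module R (carrier M \<times> carrier N))"
    and "t = tensor_kernel R M N +>\<^bsub>free_module R (carrier M \<times> carrier N)\<^esub> u"
  using assms unfolding tensor_product_def by (auto elim!: a_rcosetsE)

text \<open>Zero and scalar multiples get no case of their own, because
  \<open>0 = 0 \<otimes> 0\<close> and \<open>r (x \<otimes> y) = (r x) \<otimes> y\<close> are pure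
  tensors.\<close>

lemma tensor_induct [consumes 3, case_names pure add]:
  assumes "module R M" "module R N" "t \<in> carrier (tensor_product R M N)"
    and pure: "\<And>x y. x \<in> carrier M \<Longrightarrow> y \<in> carrier N \<Longrightarrow> P (pure_tensor R M N x y)"
    and add: "\<And>s t. s \<in> carrier (tensor_product R M N) \<Longrightarrow> t \<in> carrier (tensor_product R M N)
      \<Longrightarrow> P s \<Longrightarrow> P t \<Longrightarrow> P (s \<oplus>\<^bsub>tensor_product R M N\<^esub> t)"
  shows "P t"
proof -
  interpret M: module R M by fact
  interpret N: module R N by fact
  let ?F = "free_module R (carrier M \<times> carrier N)" and ?T = "tensor_product R M N"
  let ?\<pi> = "\<lambda>u. tensor_kernel R M N +>\<^bsub>?F\<^esub> u"
  interpret F: module R ?F by (rule M.R.free_module_module)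
  interpret T: module R ?T by (rule tensor_product_module[OF assms(1,2)])
  have \<pi>: "?\<pi> \<in> linear_maps R ?F ?T" by (rule tensor_product_proj_linear[OF assms(1,2)])
  note lin = linear_mapsD[OF \<pi>]
  obtain u where u: "u \<in> carrier ?F" "t = ?\<pi> u"
    using assms(3) by (rule tensor_product_carrierE)
  from u(1) have "P (?\<pi> u)"
  proof (induction u rule: M.R.free_module_induct)
    case zero
    have "?\<pi> \<zero>\<^bsub>?F\<^esub> = \<zero>\<^bsub>?T\<^esub>"
      by (rule linear_maps_zero[OF F.module_axioms T.module_axioms \<pi>])
    also have "\<dots> = pure_tensor R M N \<zero>\<^bsub>M\<^esub> \<zero>\<^bsub>N\<^esub>"
      using linear_maps_zero[OF assms(2) T.module_axioms
          bilinear_map_linear(1)[OF pure_tensor_bilinear[OF assms(1,2)]], of "\<zero>\<^bsub>M\<^esub>"] by simp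
    finally show ?case using pure[of "\<zero>\<^bsub>M\<^esub>" "\<zero>\<^bsub>N\<^esub>"] by simp
  next
    case (gen u r s)
    obtain x y where s: "s = (x, y)" "x \<in> carrier M" "y \<in> carrier N"
      using gen(3) by auto
    have e: "free_gen R s \<in> carrier ?F" using gen(3) by (rule M.R.free_gen_closed)
    have "?\<pi> (u \<oplus>\<^bsub>?F\<^esub> r \<odot>\<^bsub>?F\<^esub> free_gen R s) = ?\<pi> u \<oplus>\<^bsub>?T\<^esub> r \<odot>\<^bsub>?T\<^esub> pure_tensor R M N x y"
      unfolding pure_tensor_def s(1)[symmetric]
      by (simp only: lin(2)[OF gen(1) F.smult_closed[OF gen(2) e]] lin(3)[OF gen(2) e])
    also have "r \<odot>\<^bsub>?T\<^esub> pure_tensor R M N x y = pure_tensor R M N (r \<odot>\<^bsub>M\<^esub> x) y"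
      using linear_maps_smult[OF bilinear_map_linear(2)[OF pure_tensor_bilinear[OF assms(1,2)] s(3)]
          gen(2) s(2)] by simp
    finally show ?case
      using gen s by (auto intro!: add lin(1) pure pure_tensor_closed assms(1,2))
  qed
  with u show ?thesis by simp
qed

section \<open>Universal property of the tensor product: uniqueness and existence of lifts\<close>

lemma linear_maps_tensor_eqI:
  assumes "module R M" "module R N"
    and "g \<in> linear_maps R (tensor_product R M N) P" "h \<in> linear_maps R (tensor_product R M N) P"
    and "\<And>x y. x \<in> carrier M \<Longrightarrow> y \<in> carrier N \<Longrightarrow> g (pure_tensor R M N x y) = h (pure_tensor R M N x y)"
    and "t \<in> carrier (tensor_product R M N)"
  shows "g t = h t"
  using assms(1,2,6)
  by (induction rule: tensor_induct) (simp_all add: assms(5) linear_maps_add[OF assms(3)] linear_maps_add[OF assms(4)])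

text \<open>The representative picked by \<open>SOME\<close> does not influence the value: the
  linear extension of \<phi> vanishes on the relators by bilinearity, hence on
  \<open>tensor_kernel\<close>, and so it is constant on each coset.\<close>

lemma tensor_lift_coset:
  assumes "module R M" "module R N" "module R P" and \<phi>: "bilinear_map R M N P \<phi>"
    and u: "u \<in> carrier (free_module R (carrier M \<times> carrier N))"
  shows "tensor_lift R M N P \<phi> (tensor_kernel R M N +>\<^bsub>free_module R (carrier M \<times> carrier N)\<^esub> u)
    = free_lift R P (\<lambda>s. \<phi> (fst s) (snd s)) u"
proof -
  interpret M: module R M by fact
  interpret N: module R N by fact
  interpret P: module R P by fact
  let ?F = "free_module R (carrier M \<times> carrier N)" and ?K = "tensor_kernel R M N"
  let ?L = "free_lift R P (\<lambda>s. \<phi> (fst s) (snd s))"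
  interpret F: module R ?F by (rule M.R.free_module_module)
  note \<phi>1 = linear_mapsD[OF bilinear_map_linear(1)[OF \<phi>]]
    and \<phi>2 = linear_mapsD[OF bilinear_map_linear(2)[OF \<phi>]]
  have cl: "(\<lambda>s. \<phi> (fst s) (snd s)) \<in> carrier M \<times> carrier N \<rightarrow> carrier P"
    using \<phi>1(1) by auto
  have L: "?L \<in> linear_maps R ?F P" by (rule P.free_lift_linear[OF cl])
  note Lmin = linear_maps_minus[OF F.module_axioms P.module_axioms L]
  have e: "free_gen R (x, y) \<in> carrier ?F" if "x \<in> carrier M" "y \<in> carrier N" for x y
    using that by (intro M.R.free_gen_closed) auto
  have Le: "?L (free_gen R (x, y)) = \<phi> x y" if "x \<in> carrier M" "y \<in> carrier N" for x y
    using P.free_lift_gen[OF cl] that by auto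
  have "?K \<subseteq> {u \<in> carrier ?F. ?L u = \<zero>\<^bsub>P\<^esub>}"
    unfolding tensor_kernel_def
  proof (rule submodule_generated_least)
    show "submodule {u \<in> carrier ?F. ?L u = \<zero>\<^bsub>P\<^esub>} R ?F"
      by (rule linear_maps_kernel_submodule[OF F.module_axioms P.module_axioms L])
    show "tensor_relators R M N \<subseteq> {u \<in> carrier ?F. ?L u = \<zero>\<^bsub>P\<^esub>}"
      using M.relators_closed[OF assms(2)]
      unfolding tensor_relators_def Let_def
      by (auto simp del: free_module_simps simp add: Lmin linear_mapsD[OF L] e Le \<phi>1 \<phi>2 P.a_minus_eq_zero)
  qed
  \<comment> \<open>The coset is inhabited, so the choice operator returns one of its elements,
    which has the form \<open>w + u\<close> with \<open>w\<close> in the kernel.\<close>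
  moreover have "u \<in> ?K +>\<^bsub>?F\<^esub> u"
    using F.submodule_abelian_subgroup[OF tensor_kernel_submodule[OF assms(1,2)]] u
    by (rule abelian_subgroup.a_rcos_self)
  then have "(SOME v. v \<in> ?K +>\<^bsub>?F\<^esub> u) \<in> ?K +>\<^bsub>?F\<^esub> u"
    by (rule someI[where P = "\<lambda>v. v \<in> ?K +>\<^bsub>?F\<^esub> u"])
  ultimately obtain w where w: "(SOME v. v \<in> ?K +>\<^bsub>?F\<^esub> u) = w \<oplus>\<^bsub>?F\<^esub> u" "w \<in> carrier ?F" "?L w = \<zero>\<^bsub>P\<^esub>"
    by (auto simp: a_r_coset_def' simp del: free_module_simps)
  have "?L (w \<oplus>\<^bsub>?F\<^esub> u) = ?L u"
    using linear_maps_add[OF L w(2) u] w(3) linear_maps_closed[OF L u] by simp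
  then show ?thesis
    unfolding tensor_lift_def Let_def w(1) free_lift_def .
qed

lemma tensor_lift_linear:
  assumes "module R M" "module R N" "module R P" and \<phi>: "bilinear_map R M N P \<phi>"
  shows "tensor_lift R M N P \<phi> \<in> linear_maps R (tensor_product R M N) P"
proof -
  interpret M: module R M by fact
  interpret P: module R P by fact
  let ?F = "free_module R (carrier M \<times> carrier N)"
  interpret F: module R ?F by (rule M.R.free_module_module)
  note lin = linear_maps_add[OF tensor_product_proj_linear[OF assms(1,2)], symmetric]
    linear_maps_smult[OF tensor_product_proj_linear[OF assms(1,2)], symmetric]
  have "(\<lambda>s. \<phi> (fst s) (snd s)) \<in> carrier M \<times> carrier N \<rightarrow> carrier P"
    using linear_maps_closed[OF bilinear_map_linear(1)[OF \<phi>]] by auto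
  note L = linear_mapsD[OF P.free_lift_linear[OF this]]
  show ?thesis
    by (rule linear_mapsI)
      (auto elim!: tensor_product_carrierE simp del: free_module_simps simp: L lin tensor_lift_coset[OF assms])
qed

lemma tensor_lift_pure:
  assumes "module R M" "module R N" "module R P" and \<phi>: "bilinear_map R M N P \<phi>"
    and "x \<in> carrier M" "y \<in> carrier N"
  shows "tensor_lift R M N P \<phi> (pure_tensor R M N x y) = \<phi> x y"
proof -
  interpret P: module R P by fact
  have "(\<lambda>s. \<phi> (fst s) (snd s)) \<in> carrier M \<times> carrier N \<rightarrow> carrier P"
    using linear_maps_closed[OF bilinear_map_linear(1)[OF \<phi>]] by auto
  then show ?thesis
    using assms(5,6) unfolding pure_tensor_def
    using P.free_lift_gen[of "\<lambda>s. \<phi> (fst s) (snd s)" "carrier M \<times> carrier N" "(x, y)"]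
    by (simp add: tensor_lift_coset[OF assms(1-4)] P.R.free_gen_closed)
qed

section \<open>Functoriality of the tensor product\<close>

lemma tensor_map_bilinear:
  assumes "module R M'" "module R N'" "g \<in> linear_maps R M M'" "h \<in> linear_maps R N N'"
  shows "bilinear_map R M N (tensor_product R M' N') (\<lambda>x y. pure_tensor R M' N' (g x) (h y))"
  by (rule bilinear_map_comp[OF pure_tensor_bilinear[OF assms(1,2)] assms(3,4)])

lemma tensor_map_linear:
  assumes "module R M" "module R N" "module R M'" "module R N'"
    and "g \<in> linear_maps R M M'" "h \<in> linear_maps R N N'"
  shows "tensor_map R M N M' N' g h \<in> linear_maps R (tensor_product R M N) (tensor_product R M' N')"
  unfolding tensor_map_def
  by (intro tensor_lift_linear tensor_map_bilinear tensor_product_module assms)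

lemma tensor_map_pure:
  assumes "module R M" "module R N" "module R M'" "module R N'"
    and "g \<in> linear_maps R M M'" "h \<in> linear_maps R N N'" "x \<in> carrier M" "y \<in> carrier N"
  shows "tensor_map R M N M' N' g h (pure_tensor R M N x y) = pure_tensor R M' N' (g x) (h y)"
  unfolding tensor_map_def
  by (intro tensor_lift_pure tensor_map_bilinear tensor_product_module assms)

lemma tensor_map_comp:
  assumes "module R M" "module R N" "module R M'" "module R N'" "module R M''" "module R N''"
    and "g \<in> linear_maps R M M'" "h \<in> linear_maps R N N'"
    and "g' \<in> linear_maps R M' M''" "h' \<in> linear_maps R N' N''"
    and "t \<in> carrier (tensor_product R M N)"
  shows "tensor_map R M' N' M'' N'' g' h' (tensor_map R M N M' N' g h t)
    = tensor_map R M N M'' N'' (\<lambda>x. g' (g x)) (\<lambda>y. h' (h y)) t"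
  by (rule linear_maps_tensor_eqI[OF assms(1,2) linear_maps_comp[OF tensor_map_linear tensor_map_linear] tensor_map_linear])
    (simp_all add: assms tensor_map_pure linear_maps_comp[OF assms(7,9)] linear_maps_comp[OF assms(8,10)]
      linear_maps_closed[OF assms(7)] linear_maps_closed[OF assms(8)])

lemma linear_maps_cong:
  assumes "module R M" "g \<in> linear_maps R M N" "\<And>x. x \<in> carrier M \<Longrightarrow> g x = g' x"
  shows "g' \<in> linear_maps R M N"
proof -
  interpret M: module R M by fact
  show ?thesis
    by (rule linear_mapsI) (simp_all flip: assms(3) add: linear_mapsD[OF assms(2)])
qed

text \<open>Functions that agree on a carrier need not be equal in HOL, so expressions such as
  \<open>p (p x)\<close> and \<open>p x\<close> cannot be exchanged inside \<open>tensor_map\<close>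
  by plain rewriting.\<close>

lemma tensor_map_cong:
  assumes "module R M" "module R N" "module R M'" "module R N'"
    and "g \<in> linear_maps R M M'" "h \<in> linear_maps R N N'"
    and "\<And>x. x \<in> carrier M \<Longrightarrow> g x = g' x" "\<And>y. y \<in> carrier N \<Longrightarrow> h y = h' y"
    and "t \<in> carrier (tensor_product R M N)"
  shows "tensor_map R M N M' N' g h t = tensor_map R M N M' N' g' h' t"
proof -
  note g' = linear_maps_cong[OF assms(1,5,7)] and h' = linear_maps_cong[OF assms(2,6,8)]
  show ?thesis
    by (rule linear_maps_tensor_eqI[OF assms(1,2) tensor_map_linear tensor_map_linear])
      (simp_all add: assms(1-6,9) g' h' tensor_map_pure assms(7,8)[symmetric])
qed

lemma tensor_map_id:
  assumes "module R M" "module R N" "t \<in> carrier (tensor_product R M N)"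
  shows "tensor_map R M N M N (\<lambda>x. x) (\<lambda>y. y) t = t"
  by (rule linear_maps_tensor_eqI[OF assms(1,2) tensor_map_linear linear_maps_id])
    (simp_all add: assms linear_maps_id tensor_map_pure)

lemma linear_maps_add_pointwise:
  assumes "module R M" "module R N" "g \<in> linear_maps R M N" "h \<in> linear_maps R M N"
  shows "(\<lambda>x. g x \<oplus>\<^bsub>N\<^esub> h x) \<in> linear_maps R M N"
proof -
  interpret N: module R N by fact
  show ?thesis
    by (rule linear_mapsI)
      (simp_all add: linear_mapsD[OF assms(3)] linear_mapsD[OF assms(4)] N.smult_r_distr N.a_ac)
qed

lemma tensor_map_add_left:
  assumes "module R M" "module R N" "module R M'" "module R N'"
    and g: "g \<in> linear_maps R M M'" and g': "g' \<in> linear_maps R M M'" and h: "h \<in> linear_maps R N N'"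
    and "t \<in> carrier (tensor_product R M N)"
  shows "tensor_map R M N M' N' (\<lambda>x. g x \<oplus>\<^bsub>M'\<^esub> g' x) h t
    = tensor_map R M N M' N' g h t \<oplus>\<^bsub>tensor_product R M' N'\<^esub> tensor_map R M N M' N' g' h t"
proof (rule linear_maps_tensor_eqI[OF assms(1,2), where P = "tensor_product R M' N'"])
  fix x y assume xy: "x \<in> carrier M" "y \<in> carrier N"
  then show "tensor_map R M N M' N' (\<lambda>x. g x \<oplus>\<^bsub>M'\<^esub> g' x) h (pure_tensor R M N x y)
    = tensor_map R M N M' N' g h (pure_tensor R M N x y)
      \<oplus>\<^bsub>tensor_product R M' N'\<^esub> tensor_map R M N M' N' g' h (pure_tensor R M N x y)"
    using linear_maps_add[OF bilinear_map_linear(2)[OF pure_tensor_bilinear[OF assms(3,4)]]]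
      linear_maps_closed[OF g] linear_maps_closed[OF g'] linear_maps_closed[OF h]
    by (simp add: assms tensor_map_pure linear_maps_add_pointwise)
qed (simp_all add: assms linear_maps_add_pointwise tensor_map_linear tensor_product_module)

section \<open>The associativity map and its naturality\<close>

lemma tensor_assoc_bilinear:
  assumes M: "module R M" and N: "module R N" and P: "module R P" and z: "z \<in> carrier P"
  shows "bilinear_map R M N (tensor_product R M (tensor_product R N P))
    (\<lambda>x y. pure_tensor R M (tensor_product R N P) x (pure_tensor R N P y z))"
  by (rule bilinear_map_comp[OF pure_tensor_bilinear[OF M tensor_product_module[OF N P]] linear_maps_id
        bilinear_map_linear(2)[OF pure_tensor_bilinear[OF N P] z]])

text \<open>The function of \<open>t\<close> and \<open>z\<close> is itself a lift for each fixed
  \<open>z\<close>. Linearity in \<open>t\<close> is that of the inner lift; linearity in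
  \<open>z\<close> is not visible from a lift and is obtained by induction on the tensor
  \<open>t\<close>.\<close>

lemma tensor_assoc_outer_bilinear:
  assumes M: "module R M" and N: "module R N" and P: "module R P"
  defines "NP \<equiv> tensor_product R N P"
  defines "Q \<equiv> tensor_product R M NP"
  shows "bilinear_map R (tensor_product R M N) P Q
    (\<lambda>t z. tensor_lift R M N Q (\<lambda>x y. pure_tensor R M NP x (pure_tensor R N P y z)) t)"
proof (intro bilinear_mapI)
  have NP: "module R NP" unfolding NP_def by (rule tensor_product_module[OF N P])
  have Q: "module R Q" unfolding Q_def by (rule tensor_product_module[OF M NP])
  interpret P: module R P by fact
  interpret Q: module R Q by fact
  note bil = tensor_assoc_bilinear[OF M N P, folded NP_def, folded Q_def]
  note lin = tensor_lift_linear[OF M N Q bil]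
  show "tensor_lift R M N Q (\<lambda>x y. pure_tensor R M NP x (pure_tensor R N P y z))
      \<in> linear_maps R (tensor_product R M N) Q" if "z \<in> carrier P" for z
    using that by (rule lin)
  fix t assume t: "t \<in> carrier (tensor_product R M N)"
  have sub: "(\<lambda>z. pure_tensor R M NP x (pure_tensor R N P y z)) \<in> linear_maps R P Q"
    if "x \<in> carrier M" "y \<in> carrier N" for x y
    unfolding NP_def Q_def
    by (rule linear_maps_comp[OF bilinear_map_linear(1)[OF pure_tensor_bilinear[OF N P] that(2)]
        bilinear_map_linear(1)[OF pure_tensor_bilinear[OF M NP[unfolded NP_def]] that(1)]])
  show "(\<lambda>z. tensor_lift R M N Q (\<lambda>x y. pure_tensor R M NP x (pure_tensor R N P y z)) t)
      \<in> linear_maps R P Q"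
    using M N t
  proof (induction rule: tensor_induct)
    case (pure x y)
    show ?case
      using linear_maps_cong[OF P sub[OF pure]] tensor_lift_pure[OF M N Q bil pure] by simp
  next
    case (add s t)
    \<comment> \<open>The map of \<open>z\<close> at \<open>s + t\<close> is the pointwise sum of
      the maps at \<open>s\<close> and at \<open>t\<close>.\<close>
    show ?case
      by (rule linear_maps_cong[OF P linear_maps_add_pointwise[OF P Q add.IH]])
        (simp add: linear_maps_add[OF lin] add.hyps)
  qed
qed

lemma tensor_assoc_linear:
  assumes "module R M" "module R N" "module R P"
  shows "tensor_assoc R M N P
    \<in> linear_maps R (tensor_product R (tensor_product R M N) P) (tensor_product R M (tensor_product R N P))"
  unfolding tensor_assoc_def Let_def
  by (intro tensor_lift_linear tensor_assoc_outer_bilinear tensor_product_module assms)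

lemma tensor_assoc_pure:
  assumes "module R M" "module R N" "module R P" "x \<in> carrier M" "y \<in> carrier N" "z \<in> carrier P"
  shows "tensor_assoc R M N P (pure_tensor R (tensor_product R M N) P (pure_tensor R M N x y) z)
    = pure_tensor R M (tensor_product R N P) x (pure_tensor R N P y z)"
  unfolding tensor_assoc_def Let_def
  by (simp add: tensor_lift_pure tensor_assoc_outer_bilinear tensor_product_module assms
      pure_tensor_closed tensor_assoc_bilinear)

text \<open>Serves to carry coassociativity over to the image of an idempotent: it moves the
  idempotent across the rebracketing.\<close>

lemma tensor_assoc_natural:
  assumes M: "module R M" "module R N" "module R P" and M': "module R M'" "module R N'" "module R P'"
    and lin: "f \<in> linear_maps R M M'" "g \<in> linear_maps R N N'" "h \<in> linear_maps R P P'"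
    and t: "t \<in> carrier (tensor_product R (tensor_product R M N) P)"
  shows "tensor_assoc R M' N' P'
      (tensor_map R (tensor_product R M N) P (tensor_product R M' N') P' (tensor_map R M N M' N' f g) h t)
    = tensor_map R M (tensor_product R N P) M' (tensor_product R N' P') f (tensor_map R N P N' P' g h)
        (tensor_assoc R M N P t)"
    (is "?l t = ?r t")
proof (rule linear_maps_tensor_eqI[OF _ _ _ _ _ t, where P = "tensor_product R M' (tensor_product R N' P')"])
  have l: "?l \<in> linear_maps R (tensor_product R (tensor_product R M N) P) (tensor_product R M' (tensor_product R N' P'))"
    by (intro linear_maps_comp[OF tensor_map_linear tensor_assoc_linear] tensor_product_module tensor_map_linear M M' lin)
  have r: "?r \<in> linear_maps R (tensor_product R (tensor_product R M N) P) (tensor_product R M' (tensor_product R N' P'))"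
    by (intro linear_maps_comp[OF tensor_assoc_linear tensor_map_linear] tensor_product_module tensor_map_linear M M' lin)
  show "?l \<in> linear_maps R (tensor_product R (tensor_product R M N) P) (tensor_product R M' (tensor_product R N' P'))"
    "?r \<in> linear_maps R (tensor_product R (tensor_product R M N) P) (tensor_product R M' (tensor_product R N' P'))"
    by (fact l, fact r)
  fix s z assume s: "s \<in> carrier (tensor_product R M N)" and z: "z \<in> carrier P"
  \<comment> \<open>With \<open>z\<close> fixed both sides are linear in \<open>s\<close>, so the
    reduction to pure tensors applies a second time, now inside
    \<open>M \<otimes> N\<close>.\<close>
  note pt = bilinear_map_linear(2)[OF pure_tensor_bilinear[OF tensor_product_module[OF M(1,2)] M(3)] z]
  show "?l (pure_tensor R (tensor_product R M N) P s z) = ?r (pure_tensor R (tensor_product R M N) P s z)"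
    by (rule linear_maps_tensor_eqI[OF M(1,2) linear_maps_comp[OF pt l] linear_maps_comp[OF pt r] _ s])
      (simp add: tensor_map_pure tensor_assoc_pure tensor_map_linear tensor_product_module M M' lin
        pure_tensor_closed linear_maps_closed[OF lin(1)] linear_maps_closed[OF lin(2)]
        linear_maps_closed[OF lin(3)] z)
qed (intro tensor_product_module M)+

section \<open>The right unit map and its naturality\<close>

lemma (in cring) ring_as_module_module: "module R (ring_as_module R)"
  by (rule moduleI, rule is_cring, rule abelian_groupI)
    (auto simp: ring_as_module_def a_ac m_ac l_distr r_distr intro: a_inv_closed l_neg)

lemma tensor_runit_bilinear:
  assumes "module R M"
  shows "bilinear_map R M (ring_as_module R) M (\<lambda>x r. r \<odot>\<^bsub>M\<^esub> x)"
proof -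
  interpret module R M by fact
  show ?thesis
    by (intro bilinear_mapI linear_mapsI)
      (auto simp: ring_as_module_def smult_l_distr smult_r_distr smult_assoc1 R.m_comm simp flip: smult_assoc1)
qed

lemma tensor_runit_linear:
  assumes "module R M"
  shows "tensor_runit R M \<in> linear_maps R (tensor_product R M (ring_as_module R)) M"
  unfolding tensor_runit_def
  by (intro tensor_lift_linear tensor_runit_bilinear cring.ring_as_module_module module_cring[OF assms] assms)

text \<open>On \<open>x \<otimes> r\<close> both sides give \<open>r g(x)\<close>. It is the
  counterpart, for the counit law, of the naturality of the associativity map.\<close>

lemma tensor_runit_natural:
  assumes M: "module R M" "module R N" and g: "g \<in> linear_maps R M N"
    and t: "t \<in> carrier (tensor_product R M (ring_as_module R))"
  shows "tensor_runit R N (tensor_map R M (ring_as_module R) N (ring_as_module R) g (\<lambda>r. r) t)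
    = g (tensor_runit R M t)"
proof -
  have R: "module R (ring_as_module R)"
    by (rule cring.ring_as_module_module[OF module_cring[OF M(1)]])
  have carr: "carrier (ring_as_module R) = carrier R" by (simp add: ring_as_module_def)
  show ?thesis
    by (rule linear_maps_tensor_eqI[OF M(1) R linear_maps_comp[OF tensor_map_linear tensor_runit_linear]
          linear_maps_comp[OF tensor_runit_linear g] _ t])
      (simp_all add: M R g linear_maps_id tensor_map_pure,
        simp add: tensor_runit_def tensor_lift_pure tensor_runit_bilinear M R linear_mapsD[OF g] carr)
qed

lemma linear_maps_smult_pointwise:
  assumes "module R M" "module R N" "r \<in> carrier R" "g \<in> linear_maps R M N"
  shows "(\<lambda>x. r \<odot>\<^bsub>N\<^esub> g x) \<in> linear_maps R M N"
proof -
  interpret N: module R N by fact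
  show ?thesis
    by (rule linear_mapsI)
      (simp_all add: linear_mapsD[OF assms(4)] assms(3) N.smult_r_distr N.R.m_comm flip: N.smult_assoc1)
qed

text \<open>Together with additivity this gives all linear combinations of comodule morphisms; the
  scalars \<open>-1\<close> and \<open>0\<close> then yield negatives and the zero morphism.\<close>

lemma tensor_map_smult_left:
  assumes "module R M" "module R N" "module R M'" "module R N'" and r: "r \<in> carrier R"
    and g: "g \<in> linear_maps R M M'" and h: "h \<in> linear_maps R N N'"
    and "t \<in> carrier (tensor_product R M N)"
  shows "tensor_map R M N M' N' (\<lambda>x. r \<odot>\<^bsub>M'\<^esub> g x) h t
    = r \<odot>\<^bsub>tensor_product R M' N'\<^esub> tensor_map R M N M' N' g h t"
proof (rule linear_maps_tensor_eqI[OF assms(1,2), where P = "tensor_product R M' N'"])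
  fix x y assume xy: "x \<in> carrier M" "y \<in> carrier N"
  then show "tensor_map R M N M' N' (\<lambda>x. r \<odot>\<^bsub>M'\<^esub> g x) h (pure_tensor R M N x y)
    = r \<odot>\<^bsub>tensor_product R M' N'\<^esub> tensor_map R M N M' N' g h (pure_tensor R M N x y)"
    using linear_maps_smult[OF bilinear_map_linear(2)[OF pure_tensor_bilinear[OF assms(3,4)]] r]
      linear_maps_closed[OF g] linear_maps_closed[OF h]
    by (simp add: assms tensor_map_pure linear_maps_smult_pointwise)
qed (simp_all add: assms linear_maps_smult_pointwise tensor_map_linear tensor_product_module)


section \<open>Comodule morphisms\<close>

text \<open>Locale facts in rule form, so that they can be applied to several comodules over one
  coalgebra without an interpretation for each.\<close>

lemma right_comodule_modules:
  assumes "right_comodule R C M"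
  shows "module R M" "module R C" "module R (tensor_product R M C)"
    and right_comodule_coaction_linear: "coaction M \<in> linear_maps R M (tensor_product R M C)"
proof -
  interpret right_comodule R C M by fact
  show "module R M" "module R C" by unfold_locales
  then show "module R (tensor_product R M C)" by (rule tensor_product_module)
  show "coaction M \<in> linear_maps R M (tensor_product R M C)" by (rule coaction_linear)
qed

lemmas coaction_closed = linear_maps_closed[OF right_comodule_coaction_linear]

lemma comodule_homI:
  assumes "g \<in> linear_maps R M N"
    and "\<And>m. m \<in> carrier M \<Longrightarrow> coaction N (g m) = tensor_map R M C N C g (\<lambda>c. c) (coaction M m)"
  shows "g \<in> comodule_hom R C M N"
  using assms by (simp add: comodule_hom_def)

lemma comodule_homD:
  assumes "g \<in> comodule_hom R C M N"
  shows comodule_hom_linear: "g \<in> linear_maps R M N"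
    and comodule_hom_coaction:
      "m \<in> carrier M \<Longrightarrow> coaction N (g m) = tensor_map R M C N C g (\<lambda>c. c) (coaction M m)"
  using assms by (auto simp: comodule_hom_def)

lemmas comodule_hom_closed = linear_maps_closed[OF comodule_hom_linear]

lemma comodule_hom_cong:
  assumes M: "right_comodule R C M" and N: "right_comodule R C N" and g: "g \<in> comodule_hom R C M N"
    and eq: "\<And>x. x \<in> carrier M \<Longrightarrow> g x = g' x"
  shows "g' \<in> comodule_hom R C M N"
proof (rule comodule_homI)
  note lin = comodule_hom_linear[OF g]
  show "g' \<in> linear_maps R M N"
    by (rule linear_maps_cong[OF right_comodule_modules(1)[OF M] lin eq])
  fix m assume m: "m \<in> carrier M"
  show "coaction N (g' m) = tensor_map R M C N C g' (\<lambda>c. c) (coaction M m)"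
    using comodule_hom_coaction[OF g m] eq[OF m]
      tensor_map_cong[OF right_comodule_modules(1,2)[OF M] right_comodule_modules(1)[OF N]
        right_comodule_modules(2)[OF M] lin linear_maps_id eq refl coaction_closed[OF M m]]
    by simp
qed

lemma comodule_hom_id:
  assumes "right_comodule R C M"
  shows "(\<lambda>x. x) \<in> comodule_hom R C M M"
  by (rule comodule_homI)
    (simp_all add: linear_maps_id tensor_map_id right_comodule_modules[OF assms] coaction_closed[OF assms])

lemma comodule_hom_comp:
  assumes M: "right_comodule R C M" and N: "right_comodule R C N" and P: "right_comodule R C P"
    and g: "g \<in> comodule_hom R C M N" and h: "h \<in> comodule_hom R C N P"
  shows "(\<lambda>x. h (g x)) \<in> comodule_hom R C M P"
proof (rule comodule_homI)
  note lin = comodule_hom_linear[OF g] comodule_hom_linear[OF h]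
  show "(\<lambda>x. h (g x)) \<in> linear_maps R M P"
    by (rule linear_maps_comp[OF lin])
  fix m assume m: "m \<in> carrier M"
  show "coaction P (h (g m)) = tensor_map R M C P C (\<lambda>x. h (g x)) (\<lambda>c. c) (coaction M m)"
    by (simp add: comodule_hom_coaction[OF h] comodule_hom_coaction[OF g] comodule_hom_closed[OF g] m
        tensor_map_comp[OF _ _ _ _ _ _ lin(1) linear_maps_id lin(2) linear_maps_id coaction_closed[OF M]]
        right_comodule_modules[OF M] right_comodule_modules[OF N] right_comodule_modules[OF P])
qed

lemma comodule_hom_add:
  assumes M: "right_comodule R C M" and N: "right_comodule R C N"
    and g: "g \<in> comodule_hom R C M N" and h: "h \<in> comodule_hom R C M N"
  shows "(\<lambda>x. g x \<oplus>\<^bsub>N\<^esub> h x) \<in> comodule_hom R C M N"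
proof (rule comodule_homI)
  note lin = comodule_hom_linear[OF g] comodule_hom_linear[OF h]
  note mods = right_comodule_modules[OF M] right_comodule_modules[OF N]
  show "(\<lambda>x. g x \<oplus>\<^bsub>N\<^esub> h x) \<in> linear_maps R M N"
    by (rule linear_maps_add_pointwise[OF _ _ lin]) (fact mods)+
  fix m assume m: "m \<in> carrier M"
  show "coaction N (g m \<oplus>\<^bsub>N\<^esub> h m) = tensor_map R M C N C (\<lambda>x. g x \<oplus>\<^bsub>N\<^esub> h x) (\<lambda>c. c) (coaction M m)"
    by (simp add: tensor_map_add_left[OF _ _ _ _ lin linear_maps_id coaction_closed[OF M]] m mods
        linear_maps_add[OF right_comodule_coaction_linear[OF N]] comodule_hom_closed[OF g]
        comodule_hom_closed[OF h] comodule_hom_coaction[OF g] comodule_hom_coaction[OF h])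
qed

lemma comodule_hom_smult:
  assumes M: "right_comodule R C M" and N: "right_comodule R C N"
    and r: "r \<in> carrier R" and g: "g \<in> comodule_hom R C M N"
  shows "(\<lambda>x. r \<odot>\<^bsub>N\<^esub> g x) \<in> comodule_hom R C M N"
proof (rule comodule_homI)
  note lin = comodule_hom_linear[OF g]
  note mods = right_comodule_modules[OF M] right_comodule_modules[OF N]
  show "(\<lambda>x. r \<odot>\<^bsub>N\<^esub> g x) \<in> linear_maps R M N"
    by (rule linear_maps_smult_pointwise[OF _ _ r lin]) (fact mods)+
  fix m assume m: "m \<in> carrier M"
  show "coaction N (r \<odot>\<^bsub>N\<^esub> g m) = tensor_map R M C N C (\<lambda>x. r \<odot>\<^bsub>N\<^esub> g x) (\<lambda>c. c) (coaction M m)"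
    by (simp add: tensor_map_smult_left[OF _ _ _ _ r lin linear_maps_id coaction_closed[OF M]] m mods
        linear_maps_smult[OF right_comodule_coaction_linear[OF N] r] comodule_hom_closed[OF g]
        comodule_hom_coaction[OF g])
qed

lemma comodule_hom_uminus:
  assumes M: "right_comodule R C M" and N: "right_comodule R C N" and g: "g \<in> comodule_hom R C M N"
  shows "(\<lambda>x. \<ominus>\<^bsub>N\<^esub> g x) \<in> comodule_hom R C M N"
proof -
  interpret N: module R N by (rule right_comodule_modules[OF N])
  show ?thesis
    by (rule comodule_hom_cong[OF M N comodule_hom_smult[OF M N _ g, of "\<ominus>\<^bsub>R\<^esub> \<one>\<^bsub>R\<^esub>"]])
      (simp_all add: N.smult_l_minus comodule_hom_closed[OF g])
qed

lemma comodule_hom_minus: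
  assumes M: "right_comodule R C M" and N: "right_comodule R C N"
    and g: "g \<in> comodule_hom R C M N" and h: "h \<in> comodule_hom R C M N"
  shows "(\<lambda>x. g x \<ominus>\<^bsub>N\<^esub> h x) \<in> comodule_hom R C M N"
  unfolding a_minus_def by (intro comodule_hom_add[OF M N] comodule_hom_uminus[OF M N] g h)

text \<open>Obtained as the multiple \<open>0 g\<close> of a given morphism, just as the negative is
  \<open>(-1) g\<close>.\<close>

lemma comodule_hom_zero:
  assumes M: "right_comodule R C M" and N: "right_comodule R C N" and g: "g \<in> comodule_hom R C M N"
  shows "(\<lambda>x. \<zero>\<^bsub>N\<^esub>) \<in> comodule_hom R C M N"
proof -
  interpret N: module R N by (rule right_comodule_modules[OF N])
  show ?thesis
    by (rule comodule_hom_cong[OF M N comodule_hom_smult[OF M N _ g, of "\<zero>\<^bsub>R\<^esub>"]])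
      (simp_all add: comodule_hom_closed[OF g])
qed

section \<open>Inverses and isomorphisms of comodules\<close>

lemma linear_maps_inverse:
  assumes M: "module R M" and N: "module R N" and g: "g \<in> linear_maps R M N"
    and h: "\<And>n. n \<in> carrier N \<Longrightarrow> h n \<in> carrier M"
    and hg: "\<And>m. m \<in> carrier M \<Longrightarrow> h (g m) = m" and gh: "\<And>n. n \<in> carrier N \<Longrightarrow> g (h n) = n"
  shows "h \<in> linear_maps R N M"
proof (rule linear_mapsI)
  interpret M: module R M by fact
  fix x y assume xy: "x \<in> carrier N" "y \<in> carrier N"
  show "h x \<in> carrier M" using h xy by simp
  have "h (g (h x \<oplus>\<^bsub>M\<^esub> h y)) = h x \<oplus>\<^bsub>M\<^esub> h y" using xy h hg by simp
  then show "h (x \<oplus>\<^bsub>N\<^esub> y) = h x \<oplus>\<^bsub>M\<^esub> h y" using linear_maps_add[OF g] xy gh h by simp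
  fix r assume r: "r \<in> carrier R"
  have "h (g (r \<odot>\<^bsub>M\<^esub> h x)) = r \<odot>\<^bsub>M\<^esub> h x" using xy h hg r by simp
  then show "h (r \<odot>\<^bsub>N\<^esub> x) = r \<odot>\<^bsub>M\<^esub> h x" using linear_maps_smult[OF g] xy gh h r by simp
qed

text \<open>Apply \<open>h \<otimes> 1\<close> to the morphism law of \<open>g\<close> at
  \<open>h n\<close>. By functoriality and \<open>h g = 1\<close> one side becomes the coaction of
  \<open>M\<close> at \<open>h n\<close>; the other is \<open>h \<otimes> 1\<close> applied to the
  coaction of \<open>N\<close> at \<open>g (h n) = n\<close>.\<close>

lemma comodule_hom_inverse:
  assumes M: "right_comodule R C M" and N: "right_comodule R C N" and g: "g \<in> comodule_hom R C M N"
    and h: "\<And>n. n \<in> carrier N \<Longrightarrow> h n \<in> carrier M"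
    and hg: "\<And>m. m \<in> carrier M \<Longrightarrow> h (g m) = m" and gh: "\<And>n. n \<in> carrier N \<Longrightarrow> g (h n) = n"
  shows "h \<in> comodule_hom R C N M"
proof (rule comodule_homI)
  note mods = right_comodule_modules[OF M] right_comodule_modules[OF N]
  note glin = comodule_hom_linear[OF g]
  show hlin: "h \<in> linear_maps R N M"
    by (rule linear_maps_inverse[OF _ _ glin h hg gh]) (simp_all add: mods)
  fix n assume n: "n \<in> carrier N"
  have hn: "h n \<in> carrier M" by (rule h[OF n])
  have "tensor_map R N C M C h (\<lambda>c. c) (coaction N (g (h n)))
      = tensor_map R M C M C (\<lambda>x. h (g x)) (\<lambda>c. c) (coaction M (h n))"
    by (simp add: comodule_hom_coaction[OF g hn] mods
        tensor_map_comp[OF _ _ _ _ _ _ glin linear_maps_id hlin linear_maps_id coaction_closed[OF M hn]])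
  also have "\<dots> = tensor_map R M C M C (\<lambda>x. x) (\<lambda>c. c) (coaction M (h n))"
    by (rule tensor_map_cong[OF _ _ _ _ linear_maps_comp[OF glin hlin] linear_maps_id hg refl coaction_closed[OF M hn]])
      (simp_all add: mods)
  also have "\<dots> = coaction M (h n)"
    by (rule tensor_map_id[OF _ _ coaction_closed[OF M hn]]) (simp_all add: mods)
  finally show "coaction M (h n) = tensor_map R N C M C h (\<lambda>c. c) (coaction N n)"
    using gh[OF n] by simp
qed

text \<open>Allows \<open>u\<close> to be replaced by \<open>f\<close>, and \<open>-u\<close> by
  \<open>1 - f\<close>, on the summands where they agree.\<close>

lemma comodule_iso_cong:
  assumes M: "right_comodule R C M" and N: "right_comodule R C N" and g: "g \<in> comodule_iso R C M N"
    and eq: "\<And>x. x \<in> carrier M \<Longrightarrow> g x = g' x"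
  shows "g' \<in> comodule_iso R C M N"
proof -
  from g obtain h where gh: "g \<in> comodule_hom R C M N" "h \<in> comodule_hom R C N M"
    "\<forall>m\<in>carrier M. h (g m) = m" "\<forall>n\<in>carrier N. g (h n) = n"
    by (auto simp: comodule_iso_def)
  with eq comodule_hom_closed[OF gh(2)] comodule_hom_cong[OF M N gh(1) eq] show ?thesis
    by (auto simp: comodule_iso_def intro!: bexI[of _ h])
qed


section \<open>Images of idempotent endomorphisms\<close>

text \<open>The codomain \<open>M\<lparr>carrier := p ` carrier M\<rparr>\<close> in the coaction stands for the image comodule itself:
  the tensor product depends only on the carrier, the addition and the scalar multiplication of its
  factors, so the recursion in \<open>\<rho>\<^sub>K = (p \<otimes> 1) \<circ> \<rho>\<^sub>M\<close> is avoided.\<close>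

definition image_comodule ::
    "('a, 'r) ring_scheme \<Rightarrow> ('a, 'c) coalgebra \<Rightarrow> ('a, 'b, 'c) comodule \<Rightarrow> ('b \<Rightarrow> 'b) \<Rightarrow> ('a, 'b, 'c) comodule"
  where "image_comodule R C M p = M\<lparr>carrier := p ` carrier M,
    coaction := \<lambda>m. tensor_map R M C (M\<lparr>carrier := p ` carrier M\<rparr>) C p (\<lambda>c. c) (coaction M m)\<rparr>"

lemma image_comodule_sel [simp]:
  "carrier (image_comodule R C M p) = p ` carrier M"
  "add (image_comodule R C M p) = add M"
  "zero (image_comodule R C M p) = zero M"
  "smult (image_comodule R C M p) = smult M"
  by (simp_all add: image_comodule_def)

lemma image_comodule_coaction:
  "coaction (image_comodule R C M p) m
    = tensor_map R M C (image_comodule R C M p) C p (\<lambda>c. c) (coaction M m)"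
  by (simp add: image_comodule_def tensor_map_def tensor_product_def pure_tensor_def tensor_kernel_def
      tensor_relators_def tensor_lift_def)

locale comodule_idempotent = right_comodule R C M
  for R :: "('a, 'r) ring_scheme" and C :: "('a, 'c) coalgebra" and M :: "('a, 'b, 'c) comodule" +
  fixes p
  assumes p_hom: "p \<in> comodule_hom R C M M"
    and p_idem: "m \<in> carrier M \<Longrightarrow> p (p m) = p m"
begin

abbreviation "K \<equiv> image_comodule R C M p"

lemmas p_linear = comodule_hom_linear[OF p_hom]
  and p_closed = comodule_hom_closed[OF p_hom]
  and p_coaction = comodule_hom_coaction[OF p_hom]

lemma image_module: "module R K"
proof (rule moduleI)
  show "abelian_group K"
  proof (rule abelian_groupI)
    show "\<zero>\<^bsub>K\<^esub> \<in> carrier K"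
      using linear_maps_zero[OF M.module_axioms M.module_axioms p_linear]
      by (metis M.zero_closed image_comodule_sel(1,3) image_eqI)
    show "\<exists>y\<in>carrier K. y \<oplus>\<^bsub>K\<^esub> x = \<zero>\<^bsub>K\<^esub>" if x: "x \<in> carrier K" for x
    proof -
      obtain m where m: "m \<in> carrier M" "x = p m" using x by auto
      have "p (\<ominus>\<^bsub>M\<^esub> m) \<oplus>\<^bsub>M\<^esub> p m = \<zero>\<^bsub>M\<^esub>"
        using linear_maps_uminus[OF M.module_axioms M.module_axioms p_linear] m p_closed
        by (simp add: M.l_neg)
      then show ?thesis using m by auto
    qed
  qed (auto simp: p_closed M.a_ac linear_maps_add[OF p_linear, symmetric])
qed (auto simp: p_closed R.is_cring M.smult_l_distr M.smult_r_distr M.smult_assoc1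
    linear_maps_add[OF p_linear, symmetric] linear_maps_smult[OF p_linear, symmetric])

text \<open>From here on \<open>p\<close> is also read as a map from \<open>M\<close> onto
  \<open>K\<close>, with the inclusion of \<open>K\<close> as its section.\<close>

lemma p_image_linear: "p \<in> linear_maps R M K"
  using p_linear by (auto simp: linear_maps_def)

lemma incl_linear: "(\<lambda>x. x) \<in> linear_maps R K M"
  by (auto simp: linear_maps_def p_closed)

lemma p_image_id: "x \<in> carrier K \<Longrightarrow> p x = x"
  by (auto simp: p_idem)

lemmas mods = M.module_axioms module_axioms image_module

lemma coaction_M_closed: "m \<in> carrier M \<Longrightarrow> coaction M m \<in> carrier (tensor_product R M C)"
  by (rule linear_maps_closed[OF coaction_linear])

text \<open>This is the morphism law for \<open>p\<close> as a map from \<open>M\<close> to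
  \<open>K\<close>. On the left \<open>p\<close> acts twice, once through its own morphism law in
  \<open>M\<close> and once in forming the coaction of \<open>K\<close>; idempotence merges the
  two.\<close>

lemma image_coaction_p:
  assumes "m \<in> carrier M"
  shows "coaction K (p m) = tensor_map R M C K C p (\<lambda>c. c) (coaction M m)"
proof -
  have "coaction K (p m) = tensor_map R M C K C (\<lambda>x. p (p x)) (\<lambda>c. c) (coaction M m)"
    unfolding image_comodule_coaction p_coaction[OF assms]
    by (rule tensor_map_comp[OF _ _ _ _ _ _ p_linear linear_maps_id p_image_linear linear_maps_id
          coaction_M_closed[OF assms]]) (fact mods)+
  also have "\<dots> = tensor_map R M C K C p (\<lambda>c. c) (coaction M m)"
    by (rule tensor_map_cong[OF _ _ _ _ linear_maps_comp[OF p_linear p_image_linear] linear_maps_id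
          _ _ coaction_M_closed[OF assms]]) (simp_all add: mods p_idem)
  finally show ?thesis .
qed

lemma image_coaction_linear: "coaction K \<in> linear_maps R K (tensor_product R K C)"
proof -
  have "(\<lambda>x. tensor_map R M C K C p (\<lambda>c. c) (coaction M x)) \<in> linear_maps R M (tensor_product R K C)"
    by (rule linear_maps_comp[OF coaction_linear tensor_map_linear[OF _ _ _ _ p_image_linear linear_maps_id]])
      (fact mods)+
  from linear_maps_comp[OF incl_linear this] show ?thesis
    by (simp add: image_comodule_coaction[abs_def])
qed

text \<open>Both laws are those of \<open>M\<close> pushed forward along \<open>p\<close>: each side
  of coassociativity for \<open>K\<close> at \<open>x\<close> is the image under
  \<open>p \<otimes> (1 \<otimes> 1)\<close> of the same side for \<open>M\<close>, and the counit
  law turns into \<open>p x = x\<close>.\<close>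

lemma image_comodule_comodule: "right_comodule R C K"
proof (intro right_comodule.intro right_comodule_axioms.intro)
  show "coalgebra R C" by (rule coalgebra_axioms)
  show "module R K" by (rule image_module)
  show "coaction K \<in> linear_maps R K (tensor_product R K C)"
    by (rule image_coaction_linear)
  note tp = tensor_product_module
  note cm = comult_linear and cid = linear_maps_id
  fix x assume "x \<in> carrier K"
  then have x: "x \<in> carrier M" by (auto simp: p_closed)
  let ?t = "coaction M x"
  note t = coaction_M_closed[OF x]
  let ?MC = "tensor_product R M C" and ?KC = "tensor_product R K C" and ?CC = "tensor_product R C C"
  let ?pC = "tensor_map R M C K C p (\<lambda>c. c)"
  have pC: "?pC \<in> linear_maps R ?MC ?KC"
    by (rule tensor_map_linear[OF _ _ _ _ p_image_linear cid]) (fact mods)+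
  have "tensor_map R K C ?KC C (coaction K) (\<lambda>c. c) (coaction K x)
      = tensor_map R M C ?KC C (\<lambda>m. coaction K (p m)) (\<lambda>c. c) ?t"
    unfolding image_comodule_coaction[of _ _ _ _ x]
    by (rule tensor_map_comp[OF _ _ _ _ _ _ p_image_linear cid image_coaction_linear cid t])
      (simp_all add: mods tp)
  \<comment> \<open>The morphism law of \<open>p\<close> onto \<open>K\<close> eliminates the
    coaction of \<open>K\<close> in favour of that of \<open>M\<close>.\<close>
  also have "\<dots> = tensor_map R M C ?KC C (\<lambda>m. ?pC (coaction M m)) (\<lambda>c. c) ?t"
    by (rule tensor_map_cong[OF _ _ _ _ linear_maps_comp[OF p_image_linear image_coaction_linear] cid _ _ t])
      (simp_all add: mods tp image_coaction_p)
  also have "\<dots> = tensor_map R ?MC C ?KC C ?pC (\<lambda>c. c) (tensor_map R M C ?MC C (coaction M) (\<lambda>c. c) ?t)"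
    by (rule tensor_map_comp[OF _ _ _ _ _ _ coaction_linear cid pC cid t, symmetric])
      (simp_all add: mods tp)
  \<comment> \<open>Naturality brings \<open>p\<close> outside the rebracketing. The identity of
    \<open>C \<otimes> C\<close> appears here as a tensor map of two identities and is removed
    further below.\<close>
  finally have "tensor_assoc R K C C (tensor_map R K C ?KC C (coaction K) (\<lambda>c. c) (coaction K x))
      = tensor_map R M ?CC K ?CC p (tensor_map R C C C C (\<lambda>c. c) (\<lambda>c. c))
          (tensor_assoc R M C C (tensor_map R M C ?MC C (coaction M) (\<lambda>c. c) ?t))"
    using tensor_assoc_natural[OF _ _ _ _ _ _ p_image_linear cid cid
        linear_maps_closed[OF tensor_map_linear[OF _ _ _ _ coaction_linear cid] t]]
    by (simp add: mods tp)
  also have "\<dots> = tensor_map R M ?CC K ?CC p (tensor_map R C C C C (\<lambda>c. c) (\<lambda>c. c))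
      (tensor_map R M C M ?CC (\<lambda>m. m) (comult C) ?t)"
    by (simp add: coaction_coassoc[OF x])
  also have "\<dots> = tensor_map R M C K ?CC (\<lambda>m. p m)
      (\<lambda>c. tensor_map R C C C C (\<lambda>c. c) (\<lambda>c. c) (comult C c)) ?t"
    by (rule tensor_map_comp[OF _ _ _ _ _ _ cid cm p_image_linear tensor_map_linear[OF _ _ _ _ cid cid] t])
      (simp_all add: mods tp)
  also have "\<dots> = tensor_map R M C K ?CC (\<lambda>m. p m) (comult C) ?t"
    by (rule tensor_map_cong[OF _ _ _ _ p_image_linear
          linear_maps_comp[OF cm tensor_map_linear[OF _ _ _ _ cid cid]] _ _ t])
      (simp_all add: mods tp tensor_map_id linear_maps_closed[OF cm])
  also have "\<dots> = tensor_map R K C K ?CC (\<lambda>m. m) (comult C) (coaction K x)"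
    unfolding image_comodule_coaction
    by (rule tensor_map_comp[OF _ _ _ _ _ _ p_image_linear cid cid cm t, symmetric])
      (simp_all add: mods tp)
  finally show "tensor_assoc R K C C (tensor_map R K C ?KC C (coaction K) (\<lambda>x. x) (coaction K x))
      = tensor_map R K C K ?CC (\<lambda>x. x) (comult C) (coaction K x)" .
next
  fix x assume xK: "x \<in> carrier K"
  then have x: "x \<in> carrier M" by (auto simp: p_closed)
  note t = coaction_M_closed[OF x] and ram = R.ring_as_module_module
  let ?R = "ring_as_module R"
  have "tensor_map R K C K ?R (\<lambda>x. x) (counit C) (coaction K x)
      = tensor_map R M C K ?R p (counit C) (coaction M x)"
    unfolding image_comodule_coaction
    by (rule tensor_map_comp[OF _ _ _ _ _ _ p_image_linear linear_maps_id linear_maps_id counit_linear t])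
      (simp_all add: mods ram)
  also have "\<dots> = tensor_map R M ?R K ?R p (\<lambda>r. r) (tensor_map R M C M ?R (\<lambda>x. x) (counit C) (coaction M x))"
    by (rule tensor_map_comp[OF _ _ _ _ _ _ linear_maps_id counit_linear p_image_linear linear_maps_id t, symmetric])
      (simp_all add: mods ram)
  \<comment> \<open>Naturality of the unit map followed by the counit law of \<open>M\<close>; it
    remains to use that \<open>p\<close> fixes its image.\<close>
  finally have "tensor_runit R K (tensor_map R K C K ?R (\<lambda>x. x) (counit C) (coaction K x)) = p x"
    using tensor_runit_natural[OF _ _ p_image_linear
        linear_maps_closed[OF tensor_map_linear[OF _ _ _ _ linear_maps_id counit_linear] t]]
    by (simp add: mods ram coaction_counit[OF x])
  then show "tensor_runit R K (tensor_map R K C K ?R (\<lambda>x. x) (counit C) (coaction K x)) = x"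
    using p_image_id[OF xK] by simp
qed

text \<open>Following \<open>p\<close> onto \<open>K\<close> by the inclusion gives the endomorphism
  \<open>p\<close> again, so the morphism law for the inclusion at \<open>x\<close> is that of
  \<open>p\<close> at \<open>x = p x\<close>.\<close>

lemma image_subcomodule: "subcomodule R C K M"
  unfolding subcomodule_def
proof (intro conjI comodule_homI)
  show "right_comodule R C K" by (rule image_comodule_comodule)
  show "carrier K \<subseteq> carrier M" by (auto simp: p_closed)
  show "(\<lambda>x. x) \<in> linear_maps R K M" by (rule incl_linear)
  fix x assume xK: "x \<in> carrier K"
  then have x: "x \<in> carrier M" by (auto simp: p_closed)
  have "tensor_map R K C M C (\<lambda>x. x) (\<lambda>c. c) (coaction K x) = tensor_map R M C M C p (\<lambda>c. c) (coaction M x)"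
    unfolding image_comodule_coaction
    by (rule tensor_map_comp[OF _ _ _ _ _ _ p_image_linear linear_maps_id incl_linear linear_maps_id
          coaction_M_closed[OF x]]) (fact mods)+
  also have "\<dots> = coaction M x"
    using p_coaction[OF x] p_image_id[OF xK] by simp
  finally show "coaction M x = tensor_map R K C M C (\<lambda>x. x) (\<lambda>c. c) (coaction K x)" ..
qed

end

text \<open>The coaction of the image of \<open>q\<close> at \<open>g x\<close> involves
  \<open>q g\<close>, which may differ from \<open>g\<close> on \<open>M\<close>. Writing
  \<open>x\<close> as \<open>p x\<close> inserts a \<open>p\<close> on the right, and
  \<open>q g p = g p\<close> holds on all of \<open>M\<close> because \<open>q\<close> fixes its
  image.\<close>

lemma image_comodule_hom:
  assumes p: "comodule_idempotent R C M p" and q: "comodule_idempotent R C M q"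
    and g: "g \<in> comodule_hom R C M M" and gp: "g ` p ` carrier M \<subseteq> q ` carrier M"
  shows "g \<in> comodule_hom R C (image_comodule R C M p) (image_comodule R C M q)" (is "_ \<in> comodule_hom R C ?P ?Q")
proof (rule comodule_homI)
  interpret p: comodule_idempotent R C M p by (rule p)
  interpret q: comodule_idempotent R C M q by (rule q)
  note glin = comodule_hom_linear[OF g] and cid = linear_maps_id
  show gPQ: "g \<in> linear_maps R ?P ?Q"
    using glin gp p.p_closed by (auto simp: linear_maps_def)
  fix x assume xP: "x \<in> carrier ?P"
  then have x: "x \<in> carrier M" by (auto simp: p.p_closed)
  note t = p.coaction_M_closed[OF x]
  have gxQ: "g x \<in> carrier ?Q" using xP gp by auto
  have "coaction ?Q (g x) = tensor_map R M C ?Q C q (\<lambda>c. c) (tensor_map R M C M C g (\<lambda>c. c) (coaction M (p x)))"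
    unfolding image_comodule_coaction comodule_hom_coaction[OF g x] p.p_image_id[OF xP] ..
  also have "\<dots> = tensor_map R M C ?Q C (\<lambda>m. q (g m)) (\<lambda>c. c) (tensor_map R M C M C p (\<lambda>c. c) (coaction M x))"
    unfolding p.p_coaction[OF x]
    by (rule tensor_map_comp[OF _ _ _ _ _ _ glin cid q.p_image_linear cid
          linear_maps_closed[OF tensor_map_linear[OF _ _ _ _ p.p_linear cid] t]]) (fact p.mods q.mods)+
  also have "\<dots> = tensor_map R M C ?Q C (\<lambda>m. q (g (p m))) (\<lambda>c. c) (coaction M x)"
    by (rule tensor_map_comp[OF _ _ _ _ _ _ p.p_linear cid linear_maps_comp[OF glin q.p_image_linear] cid t])
      (fact p.mods q.mods)+
  also have "\<dots> = tensor_map R M C ?Q C (\<lambda>m. g (p m)) (\<lambda>c. c) (coaction M x)"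
    using gp
    by (intro tensor_map_cong[OF _ _ _ _ linear_maps_comp[OF linear_maps_comp[OF p.p_linear glin] q.p_image_linear]
          cid _ _ t] q.p_image_id refl) (auto intro: p.mods q.mods)
  also have "\<dots> = tensor_map R ?P C ?Q C g (\<lambda>c. c) (tensor_map R M C ?P C p (\<lambda>c. c) (coaction M x))"
    by (rule tensor_map_comp[OF _ _ _ _ _ _ p.p_image_linear cid gPQ cid t, symmetric])
      (fact p.mods q.mods)+
  finally show "coaction ?Q (g x) = tensor_map R ?P C ?Q C g (\<lambda>c. c) (coaction ?P x)"
    unfolding image_comodule_coaction .
qed

text \<open>The relation \<open>g p = q g\<close> passes to the inverse as \<open>h q = p h\<close>,
  so \<open>g\<close> and \<open>h\<close> both respect the images and restrict to mutually inverse
  morphisms.\<close>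

lemma image_comodule_iso:
  assumes p: "comodule_idempotent R C M p" and q: "comodule_idempotent R C M q"
    and g: "g \<in> comodule_hom R C M M" and h: "h \<in> comodule_hom R C M M"
    and hg: "\<And>m. m \<in> carrier M \<Longrightarrow> h (g m) = m" and gh: "\<And>m. m \<in> carrier M \<Longrightarrow> g (h m) = m"
    and gp: "\<And>m. m \<in> carrier M \<Longrightarrow> g (p m) = q (g m)"
  shows "g \<in> comodule_iso R C (image_comodule R C M p) (image_comodule R C M q)"
proof -
  interpret p: comodule_idempotent R C M p by (rule p)
  interpret q: comodule_idempotent R C M q by (rule q)
  note cl = comodule_hom_closed[OF g] comodule_hom_closed[OF h]
  have "h (q m) = p (h m)" if "m \<in> carrier M" for m
    using gp[of "h m"] hg[of "p (h m)"] that cl gh p.p_closed by simp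
  then have "h ` q ` carrier M \<subseteq> p ` carrier M" using cl by auto
  moreover have "g ` p ` carrier M \<subseteq> q ` carrier M" using cl gp by auto
  ultimately show ?thesis
    using image_comodule_hom[OF p q g] image_comodule_hom[OF q p h] hg gh p.p_closed q.p_closed
    unfolding comodule_iso_def by (auto intro!: bexI[of _ h])
qed

lemma complementary_idempotents_decomposition:
  assumes M: "right_comodule R C M"
    and p: "p \<in> comodule_hom R C M M" and q: "q \<in> comodule_hom R C M M"
    and sum: "\<And>m. m \<in> carrier M \<Longrightarrow> p m \<oplus>\<^bsub>M\<^esub> q m = m"
    and pq: "\<And>m. m \<in> carrier M \<Longrightarrow> p (q m) = \<zero>\<^bsub>M\<^esub>"
    and qp: "\<And>m. m \<in> carrier M \<Longrightarrow> q (p m) = \<zero>\<^bsub>M\<^esub>"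
  shows "comodule_idempotent R C M p" "comodule_idempotent R C M q"
    "comodule_decomposition R C M (image_comodule R C M p) (image_comodule R C M q)"
proof -
  interpret right_comodule R C M by (rule M)
  note cl = comodule_hom_closed[OF p] comodule_hom_closed[OF q]
  \<comment> \<open>Insert \<open>p m\<close> and \<open>q m\<close> into \<open>p + q = 1\<close>;
    the mixed terms vanish.\<close>
  have "p (p m) = p m" "q (q m) = q m" if "m \<in> carrier M" for m
    using that sum[of "p m"] sum[of "q m"] pq[of m] qp[of m] cl by auto
  then show idem: "comodule_idempotent R C M p" "comodule_idempotent R C M q"
    by (unfold_locales, use p q in simp_all)
  interpret p: comodule_idempotent R C M p by (rule idem)
  interpret q: comodule_idempotent R C M q by (rule idem)
  show "comodule_decomposition R C M (image_comodule R C M p) (image_comodule R C M q)"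
    unfolding comodule_decomposition_def
  proof (intro conjI p.image_subcomodule q.image_subcomodule)
    have "m \<in> p ` carrier M <+>\<^bsub>M\<^esub> q ` carrier M" if "m \<in> carrier M" for m
      using sum[OF that, symmetric] that by (auto simp: set_add_def')
    moreover have "p ` carrier M <+>\<^bsub>M\<^esub> q ` carrier M \<subseteq> carrier M"
      using cl by (intro M.setadd_subset_G) auto
    ultimately show "carrier (image_comodule R C M p) <+>\<^bsub>M\<^esub> carrier (image_comodule R C M q) = carrier M"
      by auto
    have "m = \<zero>\<^bsub>M\<^esub>" if "m \<in> p ` carrier M" "m \<in> q ` carrier M" for m
      using p.p_image_id[of m] that pq by auto
    \<comment> \<open>Zero is exhibited in the two images as \<open>p (q 0)\<close> and as
      \<open>q (p 0)\<close>.\<close>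
    moreover have "\<zero>\<^bsub>M\<^esub> \<in> p ` carrier M" "\<zero>\<^bsub>M\<^esub> \<in> q ` carrier M"
      using imageI[of "q \<zero>\<^bsub>M\<^esub>" "carrier M" p] imageI[of "p \<zero>\<^bsub>M\<^esub>" "carrier M" q]
      by (simp_all add: pq qp cl)
    ultimately show "carrier (image_comodule R C M p) \<inter> carrier (image_comodule R C M q) = {\<zero>\<^bsub>M\<^esub>}"
      unfolding image_comodule_sel by blast
  qed
qed


section \<open>Decompositions and projections\<close>

lemma subcomoduleD:
  assumes "subcomodule R C K M"
  shows "right_comodule R C K" "(\<lambda>x. x) \<in> comodule_hom R C K M" "x \<in> carrier K \<Longrightarrow> x \<in> carrier M"
  using assms by (auto simp: subcomodule_def)

text \<open>A subcomodule carries its own operations; linearity of the inclusion identifies them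
  with those of \<open>M\<close>, so closure under the former is closure under the latter.\<close>

lemma subcomodule_submodule:
  assumes M: "right_comodule R C M" and K: "subcomodule R C K M"
  shows "submodule (carrier K) R M"
proof -
  interpret M: module R M by (rule right_comodule_modules[OF M])
  interpret K: module R K by (rule right_comodule_modules[OF subcomoduleD(1)[OF K]])
  have lin: "(\<lambda>x. x) \<in> linear_maps R K M"
    by (rule comodule_hom_linear[OF subcomoduleD(2)[OF K]])
  show ?thesis
  proof (rule M.submoduleI)
    show "carrier K \<subseteq> carrier M" using subcomoduleD(3)[OF K] by auto
    show "\<zero>\<^bsub>M\<^esub> \<in> carrier K"
      using linear_maps_zero[OF K.module_axioms M.module_axioms lin] K.zero_closed by simp
    fix x assume x: "x \<in> carrier K"
    show "\<ominus>\<^bsub>M\<^esub> x \<in> carrier K"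
      using linear_maps_uminus[OF K.module_axioms M.module_axioms lin x] K.a_inv_closed[OF x] by simp
    show "x \<oplus>\<^bsub>M\<^esub> y \<in> carrier K" if "y \<in> carrier K" for y
      using linear_maps_add[OF lin x that] K.a_closed[OF x that] by simp
    show "r \<odot>\<^bsub>M\<^esub> x \<in> carrier K" if "r \<in> carrier R" for r
      using linear_maps_smult[OF lin that x] K.smult_closed[OF that x] by simp
  qed
qed

lemma comodule_decomposition_split:
  assumes "comodule_decomposition R C M A B" "m \<in> carrier M"
  shows "\<exists>a\<in>carrier A. \<exists>b\<in>carrier B. m = a \<oplus>\<^bsub>M\<^esub> b"
proof -
  have "m \<in> carrier A <+>\<^bsub>M\<^esub> carrier B"
    using assms by (simp add: comodule_decomposition_def)
  then show ?thesis by (auto simp: set_add_def')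
qed

text \<open>Both sides of the morphism law are additive in \<open>m\<close>, so it suffices to
  compare them on \<open>A\<close> and on \<open>B\<close>. The lemma upgrades the linear projection
  of a decomposition to a comodule morphism.\<close>

lemma comodule_hom_decomposition:
  assumes M: "right_comodule R C M" and N: "right_comodule R C N"
    and dec: "comodule_decomposition R C M A B" and g: "g \<in> linear_maps R M N"
    and gA: "g \<in> comodule_hom R C A N" and gB: "g \<in> comodule_hom R C B N"
  shows "g \<in> comodule_hom R C M N"
proof (rule comodule_homI)
  show "g \<in> linear_maps R M N" by (rule g)
  let ?g = "tensor_map R M C N C g (\<lambda>c. c)"
  note mods = right_comodule_modules[OF M] right_comodule_modules[OF N]
  \<comment> \<open>On a subcomodule the coaction of \<open>M\<close> is the image of its own
    coaction under the inclusion, so functoriality reduces the claim to the morphism law of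
    \<open>g\<close> on \<open>K\<close>.\<close>
  have sub: "coaction N (g x) = ?g (coaction M x)"
    if K: "subcomodule R C K M" and gK: "g \<in> comodule_hom R C K N" and x: "x \<in> carrier K" for K x
  proof -
    note K' = subcomoduleD(1)[OF K]
    show ?thesis
      by (simp add: comodule_hom_coaction[OF gK x] comodule_hom_coaction[OF subcomoduleD(2)[OF K] x] mods
        right_comodule_modules[OF K'] tensor_map_comp[OF _ _ _ _ _ _
          comodule_hom_linear[OF subcomoduleD(2)[OF K]] linear_maps_id g linear_maps_id coaction_closed[OF K' x]])
  qed
  fix m assume "m \<in> carrier M"
  then obtain a b where ab: "a \<in> carrier A" "b \<in> carrier B" "m = a \<oplus>\<^bsub>M\<^esub> b"
    using comodule_decomposition_split[OF dec] by blast
  have A: "subcomodule R C A M" and B: "subcomodule R C B M"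
    using dec by (auto simp: comodule_decomposition_def)
  note abM = subcomoduleD(3)[OF A ab(1)] subcomoduleD(3)[OF B ab(2)]
  have glin: "?g \<in> linear_maps R (tensor_product R M C) (tensor_product R N C)"
    by (rule tensor_map_linear[OF _ _ _ _ g linear_maps_id]) (simp_all add: mods)
  show "coaction N (g m) = ?g (coaction M m)"
    by (simp add: ab(3) linear_maps_add[OF g abM] linear_maps_closed[OF g] abM coaction_closed[OF M]
        linear_maps_add[OF right_comodule_coaction_linear[OF N]]
        linear_maps_add[OF right_comodule_coaction_linear[OF M]] linear_maps_add[OF glin]
        sub[OF A gA ab(1)] sub[OF B gB ab(2)])
qed

text \<open>Since \<open>A\<close> and \<open>B\<close> meet in zero, the component in
  \<open>B\<close> is unique and a choice operator picks it. The resulting map is zero on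
  \<open>A\<close> and the inclusion on \<open>B\<close>, both of them comodule morphisms.\<close>

lemma decomposition_projection:
  assumes M: "right_comodule R C M" and dec: "comodule_decomposition R C M A B"
  obtains e where "e \<in> comodule_hom R C M M"
    and "\<And>a b. a \<in> carrier A \<Longrightarrow> b \<in> carrier B \<Longrightarrow> e (a \<oplus>\<^bsub>M\<^esub> b) = b"
proof -
  interpret M: module R M by (rule right_comodule_modules[OF M])
  have A: "subcomodule R C A M" and B: "subcomodule R C B M"
    using dec by (auto simp: comodule_decomposition_def)
  note Asub = M.submoduleE[OF subcomodule_submodule[OF M A]]
    and Bsub = M.submoduleE[OF subcomodule_submodule[OF M B]]
  have zero: "\<zero>\<^bsub>M\<^esub> \<in> carrier A" "\<zero>\<^bsub>M\<^esub> \<in> carrier B"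
    using dec by (auto simp: comodule_decomposition_def)
  have uniq: "b = b'"
    if "a \<in> carrier A" "a' \<in> carrier A" "b \<in> carrier B" "b' \<in> carrier B" "a \<oplus>\<^bsub>M\<^esub> b = a' \<oplus>\<^bsub>M\<^esub> b'"
    for a a' b b'
  proof -
    have car: "a \<in> carrier M" "a' \<in> carrier M" "b \<in> carrier M" "b' \<in> carrier M"
      using that Asub(1) Bsub(1) by auto
    \<comment> \<open>The aim is \<open>b - b' = a' - a\<close>, an element of
      \<open>A \<inter> B\<close>.\<close>
    have "b \<ominus>\<^bsub>M\<^esub> b' = \<ominus>\<^bsub>M\<^esub> a \<oplus>\<^bsub>M\<^esub> (a \<oplus>\<^bsub>M\<^esub> b) \<ominus>\<^bsub>M\<^esub> b'"
      using car by (simp add: M.r_neg1)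
    also have "\<dots> = a' \<ominus>\<^bsub>M\<^esub> a"
      using car by (simp add: that(5) a_minus_def M.a_assoc M.r_neg M.a_comm[of a' "\<ominus>\<^bsub>M\<^esub> a"])
    finally have "b \<ominus>\<^bsub>M\<^esub> b' = a' \<ominus>\<^bsub>M\<^esub> a" .
    moreover have "b \<ominus>\<^bsub>M\<^esub> b' \<in> carrier B" "a' \<ominus>\<^bsub>M\<^esub> a \<in> carrier A"
      using that Asub(3,5) Bsub(3,5) by (auto simp: a_minus_def)
    ultimately have "b \<ominus>\<^bsub>M\<^esub> b' \<in> carrier A \<inter> carrier B" by simp
    then have "b \<ominus>\<^bsub>M\<^esub> b' = \<zero>\<^bsub>M\<^esub>"
      using dec by (auto simp: comodule_decomposition_def)
    then show ?thesis using car by (simp add: M.a_minus_eq_zero)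
  qed
  define e where "e m = (SOME b. b \<in> carrier B \<and> (\<exists>a\<in>carrier A. m = a \<oplus>\<^bsub>M\<^esub> b))" for m
  have e: "e (a \<oplus>\<^bsub>M\<^esub> b) = b" if "a \<in> carrier A" "b \<in> carrier B" for a b
    unfolding e_def using that uniq by (intro some_equality) blast+
  have split: "\<exists>a\<in>carrier A. \<exists>b\<in>carrier B. m = a \<oplus>\<^bsub>M\<^esub> b" if "m \<in> carrier M" for m
    by (rule comodule_decomposition_split[OF dec that])
  have lin: "e \<in> linear_maps R M M"
  proof (rule linear_mapsI)
    fix x assume "x \<in> carrier M"
    then obtain a b where x: "a \<in> carrier A" "b \<in> carrier B" "x = a \<oplus>\<^bsub>M\<^esub> b"
      using split by blast
    then have xc: "a \<in> carrier M" "b \<in> carrier M" using Asub(1) Bsub(1) by auto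
    show "e x \<in> carrier M" using e x xc by simp
    show "e (r \<odot>\<^bsub>M\<^esub> x) = r \<odot>\<^bsub>M\<^esub> e x" if "r \<in> carrier R" for r
      using e[of "r \<odot>\<^bsub>M\<^esub> a" "r \<odot>\<^bsub>M\<^esub> b"] e[of a b] that x xc Asub(4) Bsub(4)
      by (simp add: M.smult_r_distr)
    fix y assume "y \<in> carrier M"
    then obtain c d where y: "c \<in> carrier A" "d \<in> carrier B" "y = c \<oplus>\<^bsub>M\<^esub> d"
      using split by blast
    then have yc: "c \<in> carrier M" "d \<in> carrier M" using Asub(1) Bsub(1) by auto
    have "x \<oplus>\<^bsub>M\<^esub> y = (a \<oplus>\<^bsub>M\<^esub> c) \<oplus>\<^bsub>M\<^esub> (b \<oplus>\<^bsub>M\<^esub> d)"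
      using xc yc x(3) y(3) by (simp add: M.a_ac)
    then show "e (x \<oplus>\<^bsub>M\<^esub> y) = e x \<oplus>\<^bsub>M\<^esub> e y"
      using e x y Asub(5) Bsub(5) by simp
  qed
  \<comment> \<open>Oriented with \<open>e\<close> on the right, because
    \<open>comodule_hom_cong\<close> expects the known morphism on the left.\<close>
  have eA: "\<zero>\<^bsub>M\<^esub> = e a" if "a \<in> carrier A" for a
    using e[OF that zero(2)] Asub(1) that by auto
  have eB: "b = e b" if "b \<in> carrier B" for b
    using e[OF zero(1) that] Bsub(1) that by auto
  have "e \<in> comodule_hom R C M M"
    by (rule comodule_hom_decomposition[OF M M dec lin
          comodule_hom_cong[OF subcomoduleD(1)[OF A] M comodule_hom_zero[OF subcomoduleD(1)[OF A] M subcomoduleD(2)[OF A]] eA]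
          comodule_hom_cong[OF subcomoduleD(1)[OF B] M subcomoduleD(2)[OF B] eB]])
  then show thesis using e by (rule that)
qed


section \<open>Clean endomorphisms\<close>

lemma comodule_End_sel [simp]:
  "carrier (comodule_End R C M) = comodule_hom R C M M \<inter> extensional (carrier M)"
  "one (comodule_End R C M) = (\<lambda>m\<in>carrier M. m)"
  "zero (comodule_End R C M) = (\<lambda>m\<in>carrier M. \<zero>\<^bsub>M\<^esub>)"
  "mult (comodule_End R C M) = compose (carrier M)"
  "f \<oplus>\<^bsub>comodule_End R C M\<^esub> g = (\<lambda>m\<in>carrier M. f m \<oplus>\<^bsub>M\<^esub> g m)"
  by (simp_all add: comodule_End_def)

text \<open>Ring elements are extensional while the constructions yield arbitrary total functions;
  restriction leads from these to the ring.\<close>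

lemma comodule_hom_restrict:
  assumes "right_comodule R C M" "g \<in> comodule_hom R C M M"
  shows "restrict g (carrier M) \<in> carrier (comodule_End R C M)"
  using comodule_hom_cong[OF assms(1,1,2), of "restrict g (carrier M)"] by simp

text \<open>Gives meaning to \<open>1 - f\<close>: the negative in a ring record is a definite
  description, and the group laws are what shows that it denotes.\<close>

lemma comodule_End_abelian_group:
  assumes M: "right_comodule R C M"
  shows "abelian_group (comodule_End R C M)"
proof -
  let ?E = "comodule_End R C M"
  interpret M: module R M by (rule right_comodule_modules[OF M])
  have restr: "restrict g (carrier M) \<in> comodule_hom R C M M" if "g \<in> comodule_hom R C M M" for g
    using comodule_hom_restrict[OF M that] by simp
  show ?thesis
  proof (rule abelian_groupI)
    fix f assume f: "f \<in> carrier ?E"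
    then show "\<exists>g\<in>carrier ?E. g \<oplus>\<^bsub>?E\<^esub> f = \<zero>\<^bsub>?E\<^esub>"
      using restr[OF comodule_hom_uminus[OF M M]]
      by (intro bexI[of _ "\<lambda>m\<in>carrier M. \<ominus>\<^bsub>M\<^esub> f m"])
        (auto simp: fun_eq_iff restrict_def extensional_def M.l_neg comodule_hom_closed)
    show "\<zero>\<^bsub>?E\<^esub> \<oplus>\<^bsub>?E\<^esub> f = f"
      using f by (auto simp: fun_eq_iff restrict_def comodule_hom_closed extensional_def)
  qed (auto simp: restr[OF comodule_hom_add[OF M M]] restr[OF comodule_hom_zero[OF M M comodule_hom_id[OF M]]]
      M.a_ac comodule_hom_closed cong: restrict_cong)
qed

text \<open>The negative has no formula to unfold, so the value is read off from
  \<open>(f - g) + g = f\<close>.\<close>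

lemma comodule_End_minus:
  assumes M: "right_comodule R C M"
    and f: "f \<in> carrier (comodule_End R C M)" and g: "g \<in> carrier (comodule_End R C M)"
    and m: "m \<in> carrier M"
  shows "(f \<ominus>\<^bsub>comodule_End R C M\<^esub> g) m = f m \<ominus>\<^bsub>M\<^esub> g m"
proof -
  let ?E = "comodule_End R C M"
  interpret E: abelian_group ?E by (rule comodule_End_abelian_group[OF M])
  interpret M: module R M by (rule right_comodule_modules[OF M])
  define d where "d = f \<ominus>\<^bsub>?E\<^esub> g"
  have "d \<in> carrier ?E" unfolding d_def using f g by (rule E.minus_closed)
  then have cl: "d m \<in> carrier M" "g m \<in> carrier M"
    using g m by (auto intro: comodule_hom_closed)
  have "d \<oplus>\<^bsub>?E\<^esub> g = f"
    using E.a_inv_closed[OF g] f g unfolding d_def a_minus_def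
    by (simp only: E.a_assoc E.l_neg E.r_zero)
  then have "(\<lambda>m\<in>carrier M. d m \<oplus>\<^bsub>M\<^esub> g m) = f"
    by simp
  from fun_cong[OF this, of m] have "f m = d m \<oplus>\<^bsub>M\<^esub> g m"
    using m by simp
  then have "f m \<ominus>\<^bsub>M\<^esub> g m = d m"
    using cl by (simp add: a_minus_def M.a_assoc M.r_neg)
  then show ?thesis by (simp add: d_def)
qed

lemma clean_imp_decompositions:
  fixes R :: "('a, 'r) ring_scheme" and C :: "('a, 'c) coalgebra" and M :: "('a, 'b, 'c) comodule"
  defines "E \<equiv> comodule_End R C M"
  assumes M: "right_comodule R C M" and f: "f \<in> carrier E" and clean: "clean_element E f"
  shows "\<exists>A B X Y.
      comodule_decomposition R C M A B \<and>
      comodule_decomposition R C M X Y \<and>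
      f \<in> comodule_iso R C A X \<and>
      (\<one>\<^bsub>E\<^esub> \<ominus>\<^bsub>E\<^esub> f) \<in> comodule_iso R C B Y"
proof -
  interpret M: module R M by (rule right_comodule_modules[OF M])
  obtain u e where u: "u \<in> Units E" and e: "e \<in> carrier E" "e \<otimes>\<^bsub>E\<^esub> e = e" and fue: "f = u \<oplus>\<^bsub>E\<^esub> e"
    using clean by (auto simp: clean_element_def)
  from u obtain v where v: "v \<in> carrier E" "v \<otimes>\<^bsub>E\<^esub> u = \<one>\<^bsub>E\<^esub>" "u \<otimes>\<^bsub>E\<^esub> v = \<one>\<^bsub>E\<^esub>" and uE: "u \<in> carrier E"
    by (auto simp: Units_def)
  have hom: "u \<in> comodule_hom R C M M" "v \<in> comodule_hom R C M M" "e \<in> comodule_hom R C M M"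
    using uE v(1) e(1) by (auto simp: E_def)
  note cl = hom[THEN comodule_hom_closed] and lin = hom[THEN comodule_hom_linear]
  note add = lin[THEN linear_maps_add] and zero = lin[THEN linear_maps_zero[OF M.module_axioms M.module_axioms]]
    and uminus = lin[THEN linear_maps_uminus[OF M.module_axioms M.module_axioms]]
    and minus = lin[THEN linear_maps_minus[OF M.module_axioms M.module_axioms]]
  have vu: "v (u m) = m" if "m \<in> carrier M" for m
    using fun_cong[OF v(2), of m] that by (simp add: E_def compose_def)
  have uv: "u (v m) = m" if "m \<in> carrier M" for m
    using fun_cong[OF v(3), of m] that by (simp add: E_def compose_def)
  have ee: "e (e m) = e m" if "m \<in> carrier M" for m
    using fun_cong[OF e(2), of m] that by (simp add: E_def compose_def)
  have fm: "f m = u m \<oplus>\<^bsub>M\<^esub> e m" if "m \<in> carrier M" for m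
    using that by (simp add: fue E_def)
  define p where "p = (\<lambda>m. m \<ominus>\<^bsub>M\<^esub> e m)"
  define p' where "p' = (\<lambda>m. u (p (v m)))"
  define e' where "e' = (\<lambda>m. u (e (v m)))"
  have p: "p \<in> comodule_hom R C M M"
    unfolding p_def by (rule comodule_hom_minus[OF M M comodule_hom_id[OF M] hom(3)])
  have p': "p' \<in> comodule_hom R C M M" and e': "e' \<in> comodule_hom R C M M"
    unfolding p'_def e'_def
    by (intro comodule_hom_comp[OF M M M comodule_hom_comp[OF M M M hom(2)] hom(1)] p hom(3))+
  have pcl: "p m \<in> carrier M" if "m \<in> carrier M" for m
    by (rule comodule_hom_closed[OF p that])
  have sum: "p m \<oplus>\<^bsub>M\<^esub> e m = m" if "m \<in> carrier M" for m
    using that cl by (simp add: p_def a_minus_def M.a_assoc M.l_neg)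
  have pe: "p (e m) = \<zero>\<^bsub>M\<^esub>" if "m \<in> carrier M" for m
    using that cl by (simp add: p_def ee M.a_minus_eq_zero)
  have ep: "e (p m) = \<zero>\<^bsub>M\<^esub>" if "m \<in> carrier M" for m
    using that cl minus(3) by (simp add: p_def ee M.a_minus_eq_zero)
  note AB = complementary_idempotents_decomposition[OF M p hom(3) sum pe ep]
  \<comment> \<open>Conjugation by \<open>u\<close> preserves the relations \<open>p + e = 1\<close>
    and \<open>p e = e p = 0\<close>.\<close>
  have "p' m \<oplus>\<^bsub>M\<^esub> e' m = m" "p' (e' m) = \<zero>\<^bsub>M\<^esub>" "e' (p' m) = \<zero>\<^bsub>M\<^esub>" if "m \<in> carrier M" for m
    using that cl pcl by (simp_all add: p'_def e'_def vu uv pe ep zero sum flip: add(1))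
  note XY = complementary_idempotents_decomposition[OF M p' e' this]
  let ?A = "image_comodule R C M p" and ?B = "image_comodule R C M e"
  let ?X = "image_comodule R C M p'" and ?Y = "image_comodule R C M e'"
  have com: "right_comodule R C ?A" "right_comodule R C ?B" "right_comodule R C ?X" "right_comodule R C ?Y"
    by (auto intro: comodule_idempotent.image_comodule_comodule AB(1,2) XY(1,2))
  have "f \<in> comodule_iso R C ?A ?X"
  proof (rule comodule_iso_cong[OF com(1,3) image_comodule_iso[OF AB(1) XY(1) hom(1,2) vu uv]])
    show "u (p m) = p' (u m)" if "m \<in> carrier M" for m
      using that by (simp add: p'_def vu)
    \<comment> \<open>Here \<open>x\<close> has the form \<open>p y\<close>, and
      \<open>e p = 0\<close> leaves only \<open>u\<close> from \<open>f = u + e\<close>.\<close>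
    show "u x = f x" if "x \<in> carrier ?A" for x
      using that pcl cl by (auto simp: fm ep)
  qed
  \<comment> \<open>The isomorphism is \<open>-u\<close> with inverse \<open>-v\<close>; on the
    image of \<open>e\<close> one has \<open>e x = x\<close>, so
    \<open>x - f x = x - (u x + x) = -u x\<close>.\<close>
  moreover have "(\<one>\<^bsub>E\<^esub> \<ominus>\<^bsub>E\<^esub> f) \<in> comodule_iso R C ?B ?Y"
  proof (rule comodule_iso_cong[OF com(2,4) image_comodule_iso[OF AB(2) XY(2)
          comodule_hom_uminus[OF M M hom(1)] comodule_hom_uminus[OF M M hom(2)]]])
    show "\<ominus>\<^bsub>M\<^esub> v (\<ominus>\<^bsub>M\<^esub> u m) = m" "\<ominus>\<^bsub>M\<^esub> u (\<ominus>\<^bsub>M\<^esub> v m) = m"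
      "\<ominus>\<^bsub>M\<^esub> u (e m) = e' (\<ominus>\<^bsub>M\<^esub> u m)" if "m \<in> carrier M" for m
      using that cl by (simp_all add: uminus vu uv e'_def)
    have one: "\<one>\<^bsub>E\<^esub> \<in> carrier E"
      unfolding E_def using comodule_hom_restrict[OF M comodule_hom_id[OF M]] by simp
    show "\<ominus>\<^bsub>M\<^esub> u x = (\<one>\<^bsub>E\<^esub> \<ominus>\<^bsub>E\<^esub> f) x" if "x \<in> carrier ?B" for x
    proof -
      have x: "x \<in> carrier M" "e x = x" using that cl ee by auto
      have "(\<one>\<^bsub>E\<^esub> \<ominus>\<^bsub>E\<^esub> f) x = x \<ominus>\<^bsub>M\<^esub> (u x \<oplus>\<^bsub>M\<^esub> x)"
        using comodule_End_minus[OF M one[unfolded E_def] f[unfolded E_def] x(1)] x by (simp add: E_def fm)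
      also have "\<dots> = \<ominus>\<^bsub>M\<^esub> u x"
        using x cl by (simp add: a_minus_def M.minus_add M.a_ac M.r_neg2 M.r_neg1 M.r_neg)
      finally show ?thesis ..
    qed
  qed
  ultimately show ?thesis using AB(3) XY(3) by blast
qed

lemma decompositions_imp_clean:
  fixes R :: "('a, 'r) ring_scheme" and C :: "('a, 'c) coalgebra" and M :: "('a, 'b, 'c) comodule"
  defines "E \<equiv> comodule_End R C M"
  assumes M: "right_comodule R C M" and f: "f \<in> carrier E"
    and AB: "comodule_decomposition R C M A B" and XY: "comodule_decomposition R C M X Y"
    and fiso: "f \<in> comodule_iso R C A X" and giso: "(\<one>\<^bsub>E\<^esub> \<ominus>\<^bsub>E\<^esub> f) \<in> comodule_iso R C B Y"
  shows "clean_element E f"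
proof -
  interpret M: module R M by (rule right_comodule_modules[OF M])
  have sub: "subcomodule R C A M" "subcomodule R C B M" "subcomodule R C X M" "subcomodule R C Y M"
    using AB XY by (auto simp: comodule_decomposition_def)
  note M_subs = sub[THEN subcomodule_submodule[OF M], THEN M.submoduleE(3)]
    and subM = sub[THEN subcomoduleD(3)]
  have XY0: "carrier X \<inter> carrier Y = {\<zero>\<^bsub>M\<^esub>}"
    using XY by (auto simp: comodule_decomposition_def)
  define g where "g = \<one>\<^bsub>E\<^esub> \<ominus>\<^bsub>E\<^esub> f"
  have fhom: "f \<in> comodule_hom R C M M"
    using f by (simp add: E_def)
  have "\<one>\<^bsub>E\<^esub> \<in> carrier E"
    unfolding E_def using comodule_hom_restrict[OF M comodule_hom_id[OF M]] by simp
  then have gm: "g m = m \<ominus>\<^bsub>M\<^esub> f m" if "m \<in> carrier M" for m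
    using comodule_End_minus[OF M _ f[unfolded E_def] that, of "\<one>\<^bsub>E\<^esub>"] that
    by (simp add: g_def E_def)
  obtain h where h: "f \<in> comodule_hom R C A X" "h \<in> comodule_hom R C X A"
    "\<And>a. a \<in> carrier A \<Longrightarrow> h (f a) = a" "\<And>x. x \<in> carrier X \<Longrightarrow> f (h x) = x"
    using fiso by (auto simp: comodule_iso_def)
  obtain k where k: "g \<in> comodule_hom R C B Y" "k \<in> comodule_hom R C Y B"
    "\<And>b. b \<in> carrier B \<Longrightarrow> k (g b) = b" "\<And>y. y \<in> carrier Y \<Longrightarrow> g (k y) = y"
    using giso by (auto simp: comodule_iso_def g_def)
  obtain e where e: "e \<in> comodule_hom R C M M"
    and e_eq: "\<And>a b. a \<in> carrier A \<Longrightarrow> b \<in> carrier B \<Longrightarrow> e (a \<oplus>\<^bsub>M\<^esub> b) = b"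
    using decomposition_projection[OF M AB] by blast
  note fcl = comodule_hom_closed[OF fhom] and ecl = comodule_hom_closed[OF e]
  define u where "u = (\<lambda>m. f m \<ominus>\<^bsub>M\<^esub> e m)"
  have u: "u \<in> comodule_hom R C M M"
    unfolding u_def by (rule comodule_hom_minus[OF M M fhom e])
  \<comment> \<open>Since \<open>e\<close> takes \<open>a + b\<close> to \<open>b\<close>, the value
    is \<open>f a + (f b - b)\<close>, and \<open>f b - b\<close> is \<open>-g b\<close>.\<close>
  have u_eq: "u (a \<oplus>\<^bsub>M\<^esub> b) = f a \<ominus>\<^bsub>M\<^esub> g b" if "a \<in> carrier A" "b \<in> carrier B" for a b
    using that subM fcl linear_maps_add[OF comodule_hom_linear[OF fhom]]
    by (simp add: u_def e_eq gm a_minus_def M.minus_add M.a_ac)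
  have "u ` carrier M = carrier M"
  proof (intro equalityI subsetI)
    fix m assume "m \<in> carrier M"
    then obtain x y where xy: "x \<in> carrier X" "y \<in> carrier Y" "m = x \<oplus>\<^bsub>M\<^esub> y"
      using comodule_decomposition_split[OF XY] by blast
    note y' = M_subs(4)[OF xy(2)]
    have hk: "h x \<in> carrier A" "k (\<ominus>\<^bsub>M\<^esub> y) \<in> carrier B"
      using comodule_hom_closed[OF h(2) xy(1)] comodule_hom_closed[OF k(2) y'] by auto
    \<comment> \<open>The sign in \<open>f a - g b\<close> is compensated by taking the preimage of
      \<open>-y\<close> under \<open>g\<close>.\<close>
    have "u (h x \<oplus>\<^bsub>M\<^esub> k (\<ominus>\<^bsub>M\<^esub> y)) = m"
      using u_eq[OF hk] h(4)[OF xy(1)] k(4)[OF y'] xy subM by (simp add: a_minus_def)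
    then show "m \<in> u ` carrier M"
      using subM(1)[OF hk(1)] subM(2)[OF hk(2)] by (metis M.a_closed imageI)
  qed (auto intro: comodule_hom_closed[OF u])
  moreover have "inj_on u (carrier M)"
  proof (rule inj_onI)
    fix m n assume mn: "m \<in> carrier M" "n \<in> carrier M" "u m = u n"
    note mod = M.module_axioms
    obtain a b where ab: "a \<in> carrier A" "b \<in> carrier B" "m \<ominus>\<^bsub>M\<^esub> n = a \<oplus>\<^bsub>M\<^esub> b"
      using comodule_decomposition_split[OF AB M.minus_closed[OF mn(1,2)]] by blast
    have fa: "f a \<in> carrier X" and gb: "g b \<in> carrier Y"
      using comodule_hom_closed[OF h(1) ab(1)] comodule_hom_closed[OF k(1) ab(2)] by auto
    have "u (m \<ominus>\<^bsub>M\<^esub> n) = \<zero>\<^bsub>M\<^esub>"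
      using linear_maps_minus[OF mod mod comodule_hom_linear[OF u] mn(1,2)] mn comodule_hom_closed[OF u]
      by (simp add: M.a_minus_eq_zero)
    then have "f a = g b"
      using u_eq[OF ab(1,2)] ab(3) subM(3)[OF fa] subM(4)[OF gb] by (simp add: M.a_minus_eq_zero)
    \<comment> \<open>The common value lies in \<open>X\<close> as \<open>f a\<close> and in
      \<open>Y\<close> as \<open>g b\<close>, and these meet only in zero.\<close>
    then have f0: "f a = \<zero>\<^bsub>M\<^esub>" "g b = \<zero>\<^bsub>M\<^esub>"
      using fa gb XY0 by auto
    have fg0: "f \<zero>\<^bsub>M\<^esub> = \<zero>\<^bsub>M\<^esub>" "g \<zero>\<^bsub>M\<^esub> = \<zero>\<^bsub>M\<^esub>"
      using linear_maps_zero[OF mod mod comodule_hom_linear[OF fhom]] by (simp_all add: gm a_minus_def)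
    have "\<zero>\<^bsub>M\<^esub> \<in> carrier A" "\<zero>\<^bsub>M\<^esub> \<in> carrier B"
      using AB by (auto simp: comodule_decomposition_def)
    then have "a = \<zero>\<^bsub>M\<^esub>" "b = \<zero>\<^bsub>M\<^esub>"
      using h(3)[OF ab(1)] h(3)[of "\<zero>\<^bsub>M\<^esub>"] k(3)[OF ab(2)] k(3)[of "\<zero>\<^bsub>M\<^esub>"] f0 fg0 by auto
    then show "m = n"
      using ab(3) mn by (simp add: M.a_minus_eq_zero)
  qed
  ultimately have bij: "bij_betw u (carrier M) (carrier M)"
    by (simp add: bij_betw_def)
  define v where "v = inv_into (carrier M) u"
  have v: "v \<in> comodule_hom R C M M" and vu: "\<And>m. m \<in> carrier M \<Longrightarrow> v (u m) = m"
    and uv: "\<And>m. m \<in> carrier M \<Longrightarrow> u (v m) = m"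
  proof -
    have vcl: "v m \<in> carrier M" if "m \<in> carrier M" for m
      using bij_betwE[OF bij_betw_inv_into[OF bij]] that by (simp add: v_def)
    show vu: "v (u m) = m" if "m \<in> carrier M" for m
      unfolding v_def by (rule bij_betw_inv_into_left[OF bij that])
    show uv: "u (v m) = m" if "m \<in> carrier M" for m
      unfolding v_def by (rule bij_betw_inv_into_right[OF bij that])
    show "v \<in> comodule_hom R C M M"
      by (rule comodule_hom_inverse[OF M M u vcl vu uv])
  qed
  let ?res = "\<lambda>g. restrict g (carrier M)"
  have ee: "e (e m) = e m" if "m \<in> carrier M" for m
  proof -
    obtain a b where ab: "a \<in> carrier A" "b \<in> carrier B" "m = a \<oplus>\<^bsub>M\<^esub> b"
      using comodule_decomposition_split[OF AB \<open>m \<in> carrier M\<close>] by blast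
    \<comment> \<open>Splitting \<open>b\<close> as \<open>0 + b\<close> gives
      \<open>e b = b\<close>.\<close>
    have "\<zero>\<^bsub>M\<^esub> \<in> carrier A"
      using AB by (auto simp: comodule_decomposition_def)
    from e_eq[OF this ab(2)] show ?thesis
      using ab subM by (simp add: e_eq)
  qed
  \<comment> \<open>Restriction makes the inverse laws hold as equalities of functions, not only of
    values on \<open>M\<close>.\<close>
  have "?res u \<in> Units E"
    unfolding Units_def
    using comodule_hom_restrict[OF M u] comodule_hom_restrict[OF M v] vu uv
      comodule_hom_closed[OF u] comodule_hom_closed[OF v]
    by (auto simp: E_def compose_def cong: restrict_cong intro!: bexI[of _ "?res v"])
  moreover have "?res e \<in> carrier E"
    unfolding E_def by (rule comodule_hom_restrict[OF M e])
  moreover have "?res e \<otimes>\<^bsub>E\<^esub> ?res e = ?res e"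
    by (auto simp: E_def compose_def ee ecl cong: restrict_cong)
  \<comment> \<open>Off the carrier both sides are \<open>undefined\<close>, as \<open>f\<close> is
    extensional.\<close>
  moreover have "f = ?res u \<oplus>\<^bsub>E\<^esub> ?res e"
  proof -
    have "f m = u m \<oplus>\<^bsub>M\<^esub> e m" if "m \<in> carrier M" for m
      using that fcl ecl by (simp add: u_def a_minus_def M.a_assoc M.l_neg)
    moreover have "f \<in> extensional (carrier M)"
      using f by (simp add: E_def)
    ultimately show ?thesis
      by (auto simp: E_def fun_eq_iff restrict_def extensional_def)
  qed
  ultimately show ?thesis
    unfolding clean_element_def by blast
qed

theorem proposition1:
  fixes R :: "('a, 'r) ring_scheme" and C :: "('a, 'c) coalgebra" and M :: "('a, 'b, 'c) comodule"
    and f :: "'b \<Rightarrow> 'b"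
  defines "E \<equiv> comodule_End R C M"
  assumes "cring R"
    and "coalgebra R C"
    and "flat_module R C"
    and "right_comodule R C M"
    and "f \<in> carrier E"
  shows "clean_element E f \<longleftrightarrow>
    (\<exists>A B X Y.
      comodule_decomposition R C M A B \<and>
      comodule_decomposition R C M X Y \<and>
      f ` carrier A \<subseteq> carrier X \<and>
      (\<one>\<^bsub>E\<^esub> \<ominus>\<^bsub>E\<^esub> f) ` carrier B \<subseteq> carrier Y \<and>
      f \<in> comodule_iso R C A X \<and>
      (\<one>\<^bsub>E\<^esub> \<ominus>\<^bsub>E\<^esub> f) \<in> comodule_iso R C B Y)"
proof
  assume "clean_element E f"
  then obtain A B X Y where dec: "comodule_decomposition R C M A B" "comodule_decomposition R C M X Y"
    and iso: "f \<in> comodule_iso R C A X" "(\<one>\<^bsub>E\<^esub> \<ominus>\<^bsub>E\<^esub> f) \<in> comodule_iso R C B Y"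
    using clean_imp_decompositions[OF \<open>right_comodule R C M\<close>] \<open>f \<in> carrier E\<close> unfolding E_def by blast
  \<comment> \<open>The two inclusions of images are read off from the codomains of these
    morphisms.\<close>
  moreover from iso have "f \<in> comodule_hom R C A X" "(\<one>\<^bsub>E\<^esub> \<ominus>\<^bsub>E\<^esub> f) \<in> comodule_hom R C B Y"
    by (auto simp: comodule_iso_def)
  from this[THEN comodule_hom_closed]
  have "f ` carrier A \<subseteq> carrier X" "(\<one>\<^bsub>E\<^esub> \<ominus>\<^bsub>E\<^esub> f) ` carrier B \<subseteq> carrier Y"
    by blast+
  ultimately show "\<exists>A B X Y.
      comodule_decomposition R C M A B \<and>
      comodule_decomposition R C M X Y \<and>
      f ` carrier A \<subseteq> carrier X \<and>
      (\<one>\<^bsub>E\<^esub> \<ominus>\<^bsub>E\<^esub> f) ` carrier B \<subseteq> carrier Y \<and>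
      f \<in> comodule_iso R C A X \<and>
      (\<one>\<^bsub>E\<^esub> \<ominus>\<^bsub>E\<^esub> f) \<in> comodule_iso R C B Y"
    by blast
next
  assume "\<exists>A B X Y.
      comodule_decomposition R C M A B \<and>
      comodule_decomposition R C M X Y \<and>
      f ` carrier A \<subseteq> carrier X \<and>
      (\<one>\<^bsub>E\<^esub> \<ominus>\<^bsub>E\<^esub> f) ` carrier B \<subseteq> carrier Y \<and>
      f \<in> comodule_iso R C A X \<and>
      (\<one>\<^bsub>E\<^esub> \<ominus>\<^bsub>E\<^esub> f) \<in> comodule_iso R C B Y"
  then obtain A B X Y where "comodule_decomposition R C M A B" "comodule_decomposition R C M X Y"
    "f \<in> comodule_iso R C A X" "(\<one>\<^bsub>E\<^esub> \<ominus>\<^bsub>E\<^esub> f) \<in> comodule_iso R C B Y"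
    by auto
  then show "clean_element E f"
    using \<open>f \<in> carrier E\<close> unfolding E_def
    by (intro decompositions_imp_clean[OF \<open>right_comodule R C M\<close>])
qed

end
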